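(* If $\mathcal A$ is an operator algebra of functions on a set $X$, then its set of BPW limits $\tilde{\mathcal A}$, equipped with the matrix norms $\|\cdot\|_{M_n(\tilde{\mathcal A})}$, is a BPW complete local operator algebra of functions on $X$ which contains $\mathcal A_L$ completely isometrically as a BPW dense subalgebra.
   Context: An (abstract, unital) operator algebra is a unital algebra $\mathcal A$ with a norm on each $M_n(\mathcal A)$ satisfying the Blecher–Ruan–Sinclair (BRS) axioms: $\|LGM\|\le\|L\|\|G\|\|M\|$ for scalar matrices $L,M$; $\|G\oplus H\|=\max\{\|G\|,\|H\|\}$; $\|GH\|\le\|G\|\|H\|$ in $M_n(\mathcal A)$; $\|1\|=1$. Completeness is not assumed. An operator algebra of functions on a set $X$ is a subalgebra $\mathcal A$ of the algebra of all complex-valued functions on $X$ which separates the points of $X$ and contains the constants, is equipped with norms on all $M_n(\mathcal A)$ satisfying the BRS axioms, and is such that each evaluation functional $f\mapsto f(x)$, $x\in X$, is bounded on $\mathcal A$. For finite $F\subseteq X$ let $I_F=\{f\in\mathcal A: f|_F=0\}$, give $M_n(\mathcal A/I_F)=M_n(\mathcal A)/M_n(I_F)$ the quotient norm, and let $\pi_F:\mathcal A\to\mathcal A/I_F$ be the quotient map. $\mathcal A$ is local if $\sup_F\|(\pi_F(f_{ij}))\|=\|(f_{ij})\|$ for all $n$ and all $(f_{ij})\in M_n(\mathcal A)$, the supremum being over all finite $F\subseteq X$. $\mathcal A_L$ denotes the algebra $\mathcal A$ equipped with the matrix norms $\|(f_{ij})\|_{M_n(\mathcal A_L)}=\sup_F\|(\pi_F(f_{ij}))\|_{M_n(\mathcal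 A/I_F)}$. A function $f:X\to\mathbb C$ is a BPW limit of $\mathcal A$ if there is a net in $\mathcal A$, bounded in the norm of $\mathcal A$, converging to $f$ pointwise on $X$; $\tilde{\mathcal A}$ is the set of all BPW limits of $\mathcal A$, and $\mathcal A$ is BPW complete if $\tilde{\mathcal A}=\mathcal A$. For $(f_{ij})\in M_n(\tilde{\mathcal A})$, $$\|(f_{ij})\|_{M_n(\tilde{\mathcal A})}=\inf\{C:\ \exists\text{ a net }(f^\lambda_{ij})\in M_n(\mathcal A)\text{ with }\|(f^\lambda_{ij})\|\le C\ \forall\lambda,\ (f^\lambda_{ij}(x))\to(f_{ij}(x))\ \forall x\in X\}.$$ A subalgebra $\mathcal B$ is BPW dense in $\tilde{\mathcal A}$ if every element of $\tilde{\mathcal A}$ is the pointwise limit on $X$ of a norm-bounded net in $\mathcal B$. *)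

theory Defs
  imports
    "HOL-Analysis.L2_Norm"
    "HOL-Library.Function_Algebras"
    "Jordan_Normal_Form.Matrix"
begin

section \<open>Matrices over an algebra of functions\<close>

text \<open>The underlying set of points \<open>X\<close> is the universe of the type \<^typ>\<open>'x\<close>. (An empty \<open>X\<close> is
  impossible for an operator algebra of functions, since \<open>\<parallel>1\<parallel> = 1\<close> forces \<open>1 \<noteq> 0\<close>.)
  Functions carry the pointwise ring structure of \<^theory>\<open>HOL-Library.Function_Algebras\<close>. A family of
  norms on all \<open>M\<^sub>n(A)\<close> is one function \<open>N\<close> on matrices of all sizes; only its values on
  \<open>M\<^sub>n(A)\<close> with \<open>n \<ge> 1\<close> are ever used.\<close>

definition matrices_over :: "nat \<Rightarrow> 'a set \<Rightarrow> 'a mat set" where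
  "matrices_over n S = {G \<in> carrier_mat n n. \<forall>i<n. \<forall>j<n. G $$ (i, j) \<in> S}"

definition const_fun :: "complex \<Rightarrow> 'x \<Rightarrow> complex" where
  "const_fun c = (\<lambda>_. c)"

definition mat1 :: "'a \<Rightarrow> 'a mat" where
  "mat1 f = mat 1 1 (\<lambda>_. f)"

definition direct_sum_mat :: "'a::zero mat \<Rightarrow> 'a mat \<Rightarrow> 'a mat" where
  "direct_sum_mat G H =
     four_block_mat G (0\<^sub>m (dim_row G) (dim_col H)) (0\<^sub>m (dim_row H) (dim_col G)) H"

definition l2_norm_vec :: "complex vec \<Rightarrow> real" where
  "l2_norm_vec v = L2_set (\<lambda>i. cmod (v $ i)) {..<dim_vec v}"

definition op_norm_mat :: "complex mat \<Rightarrow> real" where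
  "op_norm_mat L = Sup {l2_norm_vec (L *\<^sub>v v) | v. v \<in> carrier_vec (dim_col L) \<and> l2_norm_vec v \<le> 1}"


section \<open>Operator algebras of functions\<close>

definition function_algebra :: "('x \<Rightarrow> complex) set \<Rightarrow> bool" where
  "function_algebra A \<longleftrightarrow>
     (\<forall>c. const_fun c \<in> A) \<and> (\<forall>f\<in>A. \<forall>g\<in>A. f + g \<in> A) \<and> (\<forall>f\<in>A. \<forall>g\<in>A. f * g \<in> A)"

definition norm_on_matrices ::
  "nat \<Rightarrow> ('x \<Rightarrow> complex) set \<Rightarrow> (('x \<Rightarrow> complex) mat \<Rightarrow> real) \<Rightarrow> bool" where
  "norm_on_matrices n A N \<longleftrightarrow>
     (\<forall>G \<in> matrices_over n A. 0 \<le> N G \<and> (N G = 0 \<longleftrightarrow> G = 0\<^sub>m n n)) \<and>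
     (\<forall>c. \<forall>G \<in> matrices_over n A. N (const_fun c \<cdot>\<^sub>m G) = cmod c * N G) \<and>
     (\<forall>G \<in> matrices_over n A. \<forall>H \<in> matrices_over n A. N (G + H) \<le> N G + N H)"

text \<open>The Blecher--Ruan--Sinclair axioms; \<open>L\<close> and \<open>M\<close> in the first axiom may be rectangular.\<close>

definition BRS_axioms ::
  "('x \<Rightarrow> complex) set \<Rightarrow> (('x \<Rightarrow> complex) mat \<Rightarrow> real) \<Rightarrow> bool" where
  "BRS_axioms A N \<longleftrightarrow>
     (\<forall>m n L G M. 0 < m \<longrightarrow> 0 < n \<longrightarrow>
        L \<in> carrier_mat m n \<longrightarrow> G \<in> matrices_over n A \<longrightarrow> M \<in> carrier_mat n m \<longrightarrow>
        N (map_mat const_fun L * G * map_mat const_fun M)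
          \<le> op_norm_mat L * N G * op_norm_mat M) \<and>
     (\<forall>m n G H. 0 < m \<longrightarrow> 0 < n \<longrightarrow> G \<in> matrices_over m A \<longrightarrow> H \<in> matrices_over n A \<longrightarrow>
        N (direct_sum_mat G H) = max (N G) (N H)) \<and>
     (\<forall>n G H. 0 < n \<longrightarrow> G \<in> matrices_over n A \<longrightarrow> H \<in> matrices_over n A \<longrightarrow>
        N (G * H) \<le> N G * N H) \<and>
     N (mat1 1) = 1"

definition operator_algebra_of_functions ::
  "('x \<Rightarrow> complex) set \<Rightarrow> (('x \<Rightarrow> complex) mat \<Rightarrow> real) \<Rightarrow> bool" where
  "operator_algebra_of_functions A N \<longleftrightarrow>
     function_algebra A \<and>
     (\<forall>x y. x \<noteq> y \<longrightarrow> (\<exists>f\<in>A. f x \<noteq> f y)) \<and>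
     (\<forall>n>0. norm_on_matrices n A N) \<and>
     BRS_axioms A N \<and>
     (\<forall>x. \<exists>K. \<forall>f\<in>A. cmod (f x) \<le> K * N (mat1 f))"


section \<open>Localization\<close>

definition vanishing_ideal :: "('x \<Rightarrow> complex) set \<Rightarrow> 'x set \<Rightarrow> ('x \<Rightarrow> complex) set" where
  "vanishing_ideal A F = {f \<in> A. \<forall>x\<in>F. f x = 0}"

text \<open>\<open>quotient_norm A N F G\<close> is the norm of the coset of \<open>G\<close> in
  \<open>M\<^sub>n(A / I\<^sub>F) = M\<^sub>n(A) / M\<^sub>n(I\<^sub>F)\<close>.\<close>

definition quotient_norm ::
  "('x \<Rightarrow> complex) set \<Rightarrow> (('x \<Rightarrow> complex) mat \<Rightarrow> real) \<Rightarrow> 'x set \<Rightarrow> ('x \<Rightarrow> complex) mat \<Rightarrow> real" where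
  "quotient_norm A N F G = (INF K \<in> matrices_over (dim_row G) (vanishing_ideal A F). N (G + K))"

definition local_norm ::
  "('x \<Rightarrow> complex) set \<Rightarrow> (('x \<Rightarrow> complex) mat \<Rightarrow> real) \<Rightarrow> ('x \<Rightarrow> complex) mat \<Rightarrow> real" where
  "local_norm A N G = (SUP F \<in> {F. finite F}. quotient_norm A N F G)"

definition local_algebra ::
  "('x \<Rightarrow> complex) set \<Rightarrow> (('x \<Rightarrow> complex) mat \<Rightarrow> real) \<Rightarrow> bool" where
  "local_algebra A N \<longleftrightarrow> (\<forall>n>0. \<forall>G \<in> matrices_over n A. local_norm A N G = N G)"


section \<open>Nets\<close>

definition directed :: "'i set \<Rightarrow> ('i \<Rightarrow> 'i \<Rightarrow> bool) \<Rightarrow> bool" where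
  "directed D rel \<longleftrightarrow> D \<noteq> {} \<and> (\<forall>i\<in>D. rel i i) \<and>
     (\<forall>i\<in>D. \<forall>j\<in>D. \<forall>k\<in>D. rel i j \<longrightarrow> rel j k \<longrightarrow> rel i k) \<and>
     (\<forall>i\<in>D. \<forall>j\<in>D. \<exists>k\<in>D. rel i k \<and> rel j k)"

definition net_converges ::
  "'i set \<Rightarrow> ('i \<Rightarrow> 'i \<Rightarrow> bool) \<Rightarrow> ('i \<Rightarrow> complex) \<Rightarrow> complex \<Rightarrow> bool" where
  "net_converges D rel u l \<longleftrightarrow> (\<forall>e>0. \<exists>i\<in>D. \<forall>j\<in>D. rel i j \<longrightarrow> dist (u j) l < e)"

definition pointwise_net ::
  "'i set \<Rightarrow> ('i \<Rightarrow> 'i \<Rightarrow> bool) \<Rightarrow> ('i \<Rightarrow> 'x \<Rightarrow> complex) \<Rightarrow> ('x \<Rightarrow> complex) set \<Rightarrow> ('x \<Rightarrow> complex) \<Rightarrow> bool"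
  where
  "pointwise_net D rel h S f \<longleftrightarrow>
     directed D rel \<and> (\<forall>d\<in>D. h d \<in> S) \<and> (\<forall>x. net_converges D rel (\<lambda>d. h d x) (f x))"

definition pointwise_mat_net ::
  "'i set \<Rightarrow> ('i \<Rightarrow> 'i \<Rightarrow> bool) \<Rightarrow> ('i \<Rightarrow> ('x \<Rightarrow> complex) mat) \<Rightarrow> ('x \<Rightarrow> complex) mat set \<Rightarrow>
    ('x \<Rightarrow> complex) mat \<Rightarrow> bool" where
  "pointwise_mat_net D rel H S G \<longleftrightarrow>
     directed D rel \<and> (\<forall>d\<in>D. H d \<in> S) \<and>
     (\<forall>x. \<forall>i<dim_row G. \<forall>j<dim_col G.
        net_converges D rel (\<lambda>d. (H d $$ (i, j)) x) ((G $$ (i, j)) x))"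

text \<open>HOL cannot quantify over the index type inside a definition, so the nets below have index sets
  inside the type \<open>'x net_index\<close>. The lemmas \<open>pointwise_net_reindex\<close> and
  \<open>pointwise_mat_net_reindex\<close> show that nets over arbitrary index types give nothing more.\<close>

type_synonym 'x net_index = "'x set \<times> nat"

lemma directed_net_index:
  "directed {(F :: 'x set, k :: nat). finite F} (\<lambda>(F, k) (F', k'). F \<subseteq> F' \<and> k \<le> k')"
  unfolding directed_def
proof (intro conjI ballI impI)
  fix p q :: "'x net_index"
  assume "p \<in> {(F, k). finite F}" "q \<in> {(F, k). finite F}"
  then show "\<exists>r\<in>{(F, k). finite F}. (case p of (F, k) \<Rightarrow> \<lambda>(F', k'). F \<subseteq> F' \<and> k \<le> k') r \<and>
      (case q of (F, k) \<Rightarrow> \<lambda>(F', k'). F \<subseteq> F' \<and> k \<le> k') r"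
    by (intro bexI[of _ "(fst p \<union> fst q, max (snd p) (snd q))"]) auto
next
  show "{(F :: 'x set, k :: nat). finite F} \<noteq> {}" by auto
qed auto

lemma net_eventually_all:
  assumes "directed D rel" "finite T" "\<And>t. t \<in> T \<Longrightarrow> net_converges D rel (u t) (l t)" "e > 0"
  shows "\<exists>i\<in>D. \<forall>j\<in>D. rel i j \<longrightarrow> (\<forall>t\<in>T. dist (u t j) (l t) < e)"
  using assms(2,3)
proof (induction T)
  case empty
  from assms(1) obtain i where "i \<in> D" unfolding directed_def by blast
  then show ?case by blast
next
  case (insert s T)
  obtain i where i: "i \<in> D" "\<forall>j\<in>D. rel i j \<longrightarrow> (\<forall>t\<in>T. dist (u t j) (l t) < e)"
    using insert.IH insert.prems by blast
  obtain i' where i': "i' \<in> D" "\<forall>j\<in>D. rel i' j \<longrightarrow> dist (u s j) (l s) < e"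
    using insert.prems[of s] \<open>e > 0\<close> unfolding net_converges_def by blast
  obtain k where k: "k \<in> D" "rel i k" "rel i' k"
    using assms(1) i(1) i'(1) unfolding directed_def by blast
  have "\<forall>j\<in>D. rel k j \<longrightarrow> rel i j \<and> rel i' j"
    using assms(1) i(1) i'(1) k unfolding directed_def by blast
  then show ?case using i i' k(1) by blast
qed

lemma net_index_converges:
  assumes "\<And>F k. finite F \<Longrightarrow> x \<in> F \<Longrightarrow> dist (u (F, k)) l < inverse (real (Suc k))"
  shows "net_converges {(F :: 'x set, k). finite F} (\<lambda>(F, k) (F', k'). F \<subseteq> F' \<and> k \<le> k') u l"
  unfolding net_converges_def
proof (intro allI impI)
  fix e :: real assume "e > 0"
  then obtain m where m: "inverse (real (Suc m)) < e" using reals_Archimedean by blast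
  have "dist (u (F, k)) l < e" if "finite F" "x \<in> F" "m \<le> k" for F k
  proof -
    have "inverse (real (Suc k)) \<le> inverse (real (Suc m))"
      using that(3) by (intro le_imp_inverse_le) auto
    then show ?thesis using assms[OF that(1,2), of k] m by linarith
  qed
  then show "\<exists>i\<in>{(F :: 'x set, k). finite F}. \<forall>j\<in>{(F, k). finite F}.
      (case i of (F, k) \<Rightarrow> \<lambda>(F', k'). F \<subseteq> F' \<and> k \<le> k') j \<longrightarrow> dist (u j) l < e"
    by (intro bexI[of _ "({x}, m)"]) auto
qed

lemma pointwise_mat_net_reindex:
  fixes G :: "('x \<Rightarrow> complex) mat"
  assumes "pointwise_mat_net (D :: 'i set) rel H S G"
  shows "\<exists>(D' :: 'x net_index set) rel' H'. pointwise_mat_net D' rel' H' S G"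
proof -
  let ?D = "{(F :: 'x set, k :: nat). finite F}"
  let ?rel = "\<lambda>(F :: 'x set, k :: nat) (F', k'). F \<subseteq> F' \<and> k \<le> k'"
  have dir: "directed D rel" using assms by (simp add: pointwise_mat_net_def)
  let ?P = "\<lambda>p d. d \<in> D \<and> (\<forall>x\<in>fst p. \<forall>i<dim_row G. \<forall>j<dim_col G.
      dist ((H d $$ (i, j)) x) ((G $$ (i, j)) x) < inverse (real (Suc (snd p))))"
  have ex: "\<exists>d. ?P p d" if p_in: "p \<in> ?D" for p
  proof -
    obtain F k where p: "p = (F, k)" "finite F" using p_in by (cases p) auto
    have "\<exists>i\<in>D. \<forall>j\<in>D. rel i j \<longrightarrow> (\<forall>t \<in> F \<times> {..<dim_row G} \<times> {..<dim_col G}.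
        dist ((H j $$ snd t) (fst t)) ((G $$ snd t) (fst t)) < inverse (real (Suc k)))"
      using assms p(2)
      by (intro net_eventually_all[OF dir]) (auto simp: pointwise_mat_net_def)
    then obtain d where d: "d \<in> D" "\<forall>j\<in>D. rel d j \<longrightarrow> (\<forall>t \<in> F \<times> {..<dim_row G} \<times> {..<dim_col G}.
        dist ((H j $$ snd t) (fst t)) ((G $$ snd t) (fst t)) < inverse (real (Suc k)))"
      by blast
    have "rel d d" using dir d(1) by (simp add: directed_def)
    with d have "?P p d" by (auto simp: p)
    then show ?thesis by blast
  qed
  define c where "c p = (SOME d. ?P p d)" for p
  have c: "?P p (c p)" if "p \<in> ?D" for p
    using someI_ex[OF ex[OF that]] unfolding c_def .
  have mem: "\<forall>p\<in>?D. H (c p) \<in> S"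
    using c assms unfolding pointwise_mat_net_def by blast
  have conv: "net_converges ?D ?rel (\<lambda>p. (H (c p) $$ (i, j)) x) ((G $$ (i, j)) x)"
    if "i < dim_row G" "j < dim_col G" for i j x
  proof (rule net_index_converges[of x])
    fix F :: "'x set" and k :: nat
    assume "finite F" "x \<in> F"
    then show "dist ((H (c (F, k)) $$ (i, j)) x) ((G $$ (i, j)) x) < inverse (real (Suc k))"
      using c[of "(F, k)"] that by auto
  qed
  have "pointwise_mat_net ?D ?rel (\<lambda>p. H (c p)) S G"
    unfolding pointwise_mat_net_def using directed_net_index mem conv by blast
  then show ?thesis by blast
qed

lemma pointwise_net_reindex:
  fixes f :: "'x \<Rightarrow> complex"
  assumes "pointwise_net (D :: 'i set) rel h S f"
  shows "\<exists>(D' :: 'x net_index set) rel' h'. pointwise_net D' rel' h' S f"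
proof -
  have "pointwise_mat_net D rel (\<lambda>d. mat1 (h d)) (mat1 ` S) (mat1 f)"
    using assms by (auto simp: pointwise_net_def pointwise_mat_net_def mat1_def)
  then obtain D' :: "'x net_index set" and rel' H'
    where *: "pointwise_mat_net D' rel' H' (mat1 ` S) (mat1 f)"
    using pointwise_mat_net_reindex by blast
  have "H' d $$ (0, 0) \<in> S" if "d \<in> D'" for d
    using * that by (force simp: pointwise_mat_net_def mat1_def)
  with * have "pointwise_net D' rel' (\<lambda>d. H' d $$ (0, 0)) S f"
    by (auto simp: pointwise_net_def pointwise_mat_net_def mat1_def)
  then show ?thesis by blast
qed


section \<open>BPW limits\<close>

definition bpw_limits ::
  "('x \<Rightarrow> complex) set \<Rightarrow> (('x \<Rightarrow> complex) mat \<Rightarrow> real) \<Rightarrow> ('x \<Rightarrow> complex) set" where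
  "bpw_limits A N = {f. \<exists>(D :: 'x net_index set) rel h C.
     pointwise_net D rel h {g \<in> A. N (mat1 g) \<le> C} f}"

definition bpw_norm ::
  "('x \<Rightarrow> complex) set \<Rightarrow> (('x \<Rightarrow> complex) mat \<Rightarrow> real) \<Rightarrow> ('x \<Rightarrow> complex) mat \<Rightarrow> real" where
  "bpw_norm A N G = Inf {C. \<exists>(D :: 'x net_index set) rel H.
     pointwise_mat_net D rel H {K \<in> matrices_over (dim_row G) A. N K \<le> C} G}"

definition bpw_complete ::
  "('x \<Rightarrow> complex) set \<Rightarrow> (('x \<Rightarrow> complex) mat \<Rightarrow> real) \<Rightarrow> bool" where
  "bpw_complete A N \<longleftrightarrow> bpw_limits A N = A"

text \<open>In the next two definitions the algebra structures are the pointwise ones, so the embedding of a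
  subalgebra is the set inclusion.\<close>

definition completely_isometric_subalgebra ::
  "('x \<Rightarrow> complex) set \<Rightarrow> (('x \<Rightarrow> complex) mat \<Rightarrow> real) \<Rightarrow>
   ('x \<Rightarrow> complex) set \<Rightarrow> (('x \<Rightarrow> complex) mat \<Rightarrow> real) \<Rightarrow> bool" where
  "completely_isometric_subalgebra B N\<^sub>B A N\<^sub>A \<longleftrightarrow>
     function_algebra B \<and> B \<subseteq> A \<and> (\<forall>n>0. \<forall>G \<in> matrices_over n B. N\<^sub>A G = N\<^sub>B G)"

definition bpw_dense_subalgebra ::
  "('x \<Rightarrow> complex) set \<Rightarrow> ('x \<Rightarrow> complex) set \<Rightarrow> (('x \<Rightarrow> complex) mat \<Rightarrow> real) \<Rightarrow> bool" where
  "bpw_dense_subalgebra B A N \<longleftrightarrow> function_algebra B \<and> B \<subseteq> A \<and> A \<subseteq> bpw_limits B N"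

end

(* Evaluations are bounded and A interpolates arbitrary values on finite sets, so uniformly small
   values on a finite set F can be interpolated on F by elements of A of small norm. Hence a bounded
   net converging pointwise to G can be corrected on each finite F to agree with G exactly, at an
   arbitrarily small cost in norm: up to an epsilon, the norm of G in the algebra of BPW limits is the
   least C such that on every finite set G agrees with an element of norm at most C. In this form
   the BRS axioms pass from A to its BPW limits by operating on interpolants, and locality, BPW
   completeness and the isometric embedding of the localization are comparisons of interpolants on
   one finite set at a time. *)

theory Submission
  imports Defs
begin

section \<open>Scalar matrices\<close>

text \<open>The interpolation constant on a finite set F depends on F, and no bound uniform in F is
  available, so a bounded net cannot be corrected on all finite sets at once. The order of choices
  resolves this: F is fixed, its constant K is taken, and only then is a member of the net chosen so
  close on F that the correction, of norm at most K times the error, fits into the gap between the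
  old bound C and a larger bound D. Since only bounds D > C come out, estimates are proved for every
  interpolation constant and the infimum is taken last. A second obstacle is that an infimum of
  reals says nothing about an empty set. The entries of a matrix of BPW limits come with unrelated
  nets and bounds, and one bounded family of matrices has to be produced from them. Working on one
  finite set at a time makes this possible: interpolants are assembled entry by entry, with a norm
  bound that is independent of F.\<close>

lemma op_norm_mat_bdd_above:
  "bdd_above {l2_norm_vec (L *\<^sub>v v) | v. v \<in> carrier_vec (dim_col L) \<and> l2_norm_vec v \<le> 1}"
proof -
  \<comment> \<open>A crude bound suffices: it only has to make the real supremum in
    \<open>op_norm_mat\<close> meaningful.\<close>
  have "l2_norm_vec (L *\<^sub>v v) \<le> (\<Sum>i<dim_row L. \<Sum>j<dim_col L. cmod (L $$ (i, j)))"
    if v: "v \<in> carrier_vec (dim_col L)" "l2_norm_vec v \<le> 1" for v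
  proof -
    have v_le: "cmod (v $ j) \<le> 1" if "j < dim_col L" for j
    proof -
      have "cmod (v $ j) \<le> L2_set (\<lambda>i. cmod (v $ i)) {..<dim_vec v}"
        using that v(1) by (intro member_le_L2_set) auto
      then show ?thesis using v(2) by (simp add: l2_norm_vec_def)
    qed
    have entry: "cmod ((L *\<^sub>v v) $ i) \<le> (\<Sum>j<dim_col L. cmod (L $$ (i, j)))" if "i < dim_row L" for i
    proof -
      have "(L *\<^sub>v v) $ i = (\<Sum>j<dim_col L. L $$ (i, j) * v $ j)"
        using that v(1) by (auto simp: scalar_prod_def lessThan_atLeast0 intro!: sum.cong)
      also have "cmod \<dots> \<le> (\<Sum>j<dim_col L. cmod (L $$ (i, j)))"
        by (rule sum_norm_le) (use v_le in \<open>auto simp: norm_mult intro: mult_left_le\<close>)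
      finally show ?thesis .
    qed
    have "l2_norm_vec (L *\<^sub>v v) \<le> (\<Sum>i<dim_row L. cmod ((L *\<^sub>v v) $ i))"
      unfolding l2_norm_vec_def dim_mult_mat_vec by (rule L2_set_le_sum) auto
    also have "\<dots> \<le> (\<Sum>i<dim_row L. \<Sum>j<dim_col L. cmod (L $$ (i, j)))"
      using entry by (intro sum_mono) auto
    finally show ?thesis .
  qed
  then show ?thesis by (auto simp: bdd_above_def)
qed

lemma l2_norm_vec_zero [simp]: "l2_norm_vec (0\<^sub>v n) = 0"
  by (simp add: l2_norm_vec_def L2_set_0')

lemma l2_norm_vec_nonneg [simp]: "0 \<le> l2_norm_vec v"
  by (simp add: l2_norm_vec_def)

lemma op_norm_mat_nonneg: "0 \<le> op_norm_mat L"
proof -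
  have "l2_norm_vec (L *\<^sub>v 0\<^sub>v (dim_col L)) \<le> op_norm_mat L"
    unfolding op_norm_mat_def by (intro cSup_upper op_norm_mat_bdd_above) auto
  then show ?thesis using l2_norm_vec_nonneg order_trans by blast
qed

lemma op_norm_mat_le_one:
  assumes "\<And>v. v \<in> carrier_vec (dim_col L) \<Longrightarrow> l2_norm_vec (L *\<^sub>v v) \<le> l2_norm_vec v"
  shows "op_norm_mat L \<le> 1"
  unfolding op_norm_mat_def
proof (rule cSup_least)
  have "0\<^sub>v (dim_col L) \<in> carrier_vec (dim_col L) \<and> l2_norm_vec (0\<^sub>v (dim_col L)) \<le> 1" by simp
  then show "{l2_norm_vec (L *\<^sub>v v) | v. v \<in> carrier_vec (dim_col L) \<and> l2_norm_vec v \<le> 1} \<noteq> {}"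
    by blast
qed (use assms order_trans in blast)

text \<open>As an operator it sends v to the vector with i-th coordinate
  \<open>v $ \<sigma> i\<close>. Multiplying by such matrices on both sides extracts a submatrix,
  which makes passing to submatrices an instance of the first BRS axiom. The entry type is left open
  because both the complex matrix and its image over the function ring occur.\<close>

definition select_mat :: "nat \<Rightarrow> nat \<Rightarrow> (nat \<Rightarrow> nat) \<Rightarrow> 'a::zero_neq_one mat" where
  "select_mat m n \<sigma> = mat m n (\<lambda>(i, j). if j = \<sigma> i then 1 else 0)"

lemma select_mat_carrier [simp]:
  "select_mat m n \<sigma> \<in> carrier_mat m n"
  "dim_row (select_mat m n \<sigma>) = m" "dim_col (select_mat m n \<sigma>) = n"
  by (simp_all add: select_mat_def)

text \<open>Injectivity ensures that no coordinate of v is counted twice, so the squared norm of the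
  image is a partial sum of that of v.\<close>

lemma op_norm_select_mat_le_one:
  assumes "inj_on \<sigma> {..<m}" "\<sigma> ` {..<m} \<subseteq> {..<n}"
  shows "op_norm_mat (select_mat m n \<sigma>) \<le> 1"
proof (rule op_norm_mat_le_one)
  fix v :: "complex vec"
  assume "v \<in> carrier_vec (dim_col (select_mat m n \<sigma> :: complex mat))"
  then have v: "dim_vec v = n" by simp
  have e: "(select_mat m n \<sigma> *\<^sub>v v) $ i = v $ \<sigma> i" if "i < m" for i
    using that v assms(2)
    by (auto simp: select_mat_def scalar_prod_def if_distrib[of "\<lambda>x. x * _"] sum.delta
        cong: if_cong)
  have "(\<Sum>i<m. (cmod ((select_mat m n \<sigma> *\<^sub>v v) $ i))\<^sup>2) = (\<Sum>i<m. (cmod (v $ \<sigma> i))\<^sup>2)"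
    by (intro sum.cong) (auto simp: e simp del: index_mult_mat_vec)
  also have "\<dots> = (\<Sum>j\<in>\<sigma> ` {..<m}. (cmod (v $ j))\<^sup>2)"
    by (simp add: sum.reindex[OF assms(1)])
  also have "\<dots> \<le> (\<Sum>j<n. (cmod (v $ j))\<^sup>2)"
    using assms(2) by (intro sum_mono2) auto
  finally show "l2_norm_vec (select_mat m n \<sigma> *\<^sub>v v) \<le> l2_norm_vec v"
    by (simp add: l2_norm_vec_def L2_set_def v)
qed

text \<open>The transpose moves the coordinates of v to the positions in the image of
  \<open>\<sigma>\<close> and fills up with zeros. By injectivity no two of them are added in one
  place, so the norm is even preserved.\<close>

lemma op_norm_select_mat_transpose_le_one:
  assumes "inj_on \<sigma> {..<m}" "\<sigma> ` {..<m} \<subseteq> {..<n}"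
  shows "op_norm_mat (select_mat m n \<sigma>)\<^sup>T \<le> 1"
proof (rule op_norm_mat_le_one)
  fix v :: "complex vec"
  assume "v \<in> carrier_vec (dim_col (select_mat m n \<sigma> :: complex mat)\<^sup>T)"
  then have v: "dim_vec v = m" by simp
  let ?w = "(select_mat m n \<sigma>)\<^sup>T *\<^sub>v v"
  have w: "?w $ j = (\<Sum>i<m. if j = \<sigma> i then v $ i else 0)" if "j < n" for j
    using that v by (auto simp: select_mat_def scalar_prod_def lessThan_atLeast0 intro!: sum.cong)
  have w_out: "?w $ j = 0" if "j < n" "j \<notin> \<sigma> ` {..<m}" for j
    unfolding w[OF that(1)] using that(2) by (intro sum.neutral) auto
  have w_in: "?w $ \<sigma> i = v $ i" if "i < m" for i
  proof -
    have "?w $ \<sigma> i = (\<Sum>k<m. if \<sigma> i = \<sigma> k then v $ k else 0)"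
      using that assms(2) by (intro w) auto
    also have "\<dots> = (\<Sum>k<m. if k = i then v $ k else 0)"
      using that assms(1) by (intro sum.cong) (auto dest: inj_onD)
    finally show ?thesis using that by simp
  qed
  have "(\<Sum>j<n. (cmod (?w $ j))\<^sup>2) = (\<Sum>j\<in>\<sigma> ` {..<m}. (cmod (?w $ j))\<^sup>2)"
    using assms(2) w_out by (intro sum.mono_neutral_right) auto
  also have "\<dots> = (\<Sum>i<m. (cmod (v $ i))\<^sup>2)"
    by (simp add: sum.reindex[OF assms(1)] w_in)
  finally show "l2_norm_vec ?w \<le> l2_norm_vec v"
    by (simp add: l2_norm_vec_def L2_set_def v)
qed

lemma select_mat_mult:
  fixes G :: "'a::comm_ring_1 mat"
  assumes "G \<in> carrier_mat n n" "\<sigma> ` {..<m} \<subseteq> {..<n}" "\<tau> ` {..<m} \<subseteq> {..<n}"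
  shows "select_mat m n \<sigma> * G * (select_mat m n \<tau>)\<^sup>T = mat m m (\<lambda>(i, j). G $$ (\<sigma> i, \<tau> j))"
proof -
  have 1: "select_mat m n \<sigma> * G = mat m n (\<lambda>(i, j). G $$ (\<sigma> i, j))"
    using assms(1,2)
    by (intro eq_matI) (auto simp: select_mat_def scalar_prod_def if_distrib[of "\<lambda>x. x * _"]
        image_subset_iff cong: if_cong)
  show ?thesis unfolding 1
    using assms(3)
    by (intro eq_matI) (auto simp: select_mat_def scalar_prod_def if_distrib[of "\<lambda>x. _ * x"]
        image_subset_iff cong: if_cong)
qed

section \<open>Matrices of functions\<close>

lemma const_fun_simps [simp]: "const_fun 0 = 0" "const_fun 1 = 1" "const_fun c x = c"
  by (auto simp: const_fun_def fun_eq_iff)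

lemma matrices_over_iff: "G \<in> matrices_over n S \<longleftrightarrow> G \<in> carrier_mat n n \<and> elements_mat G \<subseteq> S"
  unfolding matrices_over_def by auto

lemma matrices_over_carrier: "G \<in> matrices_over n S \<Longrightarrow> G \<in> carrier_mat n n"
  by (simp add: matrices_over_def)

lemma matrices_over_mono: "S \<subseteq> T \<Longrightarrow> matrices_over n S \<subseteq> matrices_over n T"
  by (auto simp: matrices_over_def)

lemma mat1_carrier [simp]: "mat1 f \<in> carrier_mat 1 1" "dim_row (mat1 f) = 1" "dim_col (mat1 f) = 1"
  "mat1 f $$ (0, 0) = f"
  by (auto simp: mat1_def)

lemma mat1_mem_matrices_over [simp]: "mat1 f \<in> matrices_over (Suc 0) S \<longleftrightarrow> f \<in> S"
  by (auto simp: matrices_over_def mat1_def)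

lemma mat1_entry: "G \<in> carrier_mat 1 1 \<Longrightarrow> mat1 (G $$ (0, 0)) = G"
  by (intro eq_matI) (auto simp: mat1_def)

text \<open>Agreement on finite sets is expressed through these evaluations because they respect all
  matrix operations: combining interpolants then interpolates the combination.\<close>

definition eval_mat :: "'x \<Rightarrow> ('x \<Rightarrow> complex) mat \<Rightarrow> complex mat" where
  "eval_mat x = map_mat (\<lambda>f. f x)"

lemma eval_mat_eq_iff:
  assumes "G \<in> carrier_mat m n" "H \<in> carrier_mat m n"
  shows "eval_mat x G = eval_mat x H \<longleftrightarrow> (\<forall>i<m. \<forall>j<n. (G $$ (i, j)) x = (H $$ (i, j)) x)"
proof
  assume e: "eval_mat x G = eval_mat x H"
  show "\<forall>i<m. \<forall>j<n. (G $$ (i, j)) x = (H $$ (i, j)) x"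
  proof (intro allI impI)
    fix i j assume "i < m" "j < n"
    then show "(G $$ (i, j)) x = (H $$ (i, j)) x"
      using arg_cong[OF e, of "\<lambda>M. M $$ (i, j)"] assms by (simp add: eval_mat_def)
  qed
qed (use assms in \<open>auto simp: eval_mat_def intro!: eq_matI\<close>)

interpretation eval_hom: semiring_hom "\<lambda>f :: 'x \<Rightarrow> complex. f x" for x
  by unfold_locales auto

lemma eval_mat_mult:
  assumes "G \<in> carrier_mat m n" "H \<in> carrier_mat n k"
  shows "eval_mat x (G * H) = eval_mat x G * eval_mat x H"
  unfolding eval_mat_def by (rule eval_hom.mat_hom_mult[OF assms])

lemma eval_mat_add:
  assumes "G \<in> carrier_mat m n" "H \<in> carrier_mat m n"
  shows "eval_mat x (G + H) = eval_mat x G + eval_mat x H"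
  using assms by (intro eq_matI) (auto simp: eval_mat_def)

lemma eval_mat_zero [simp]: "eval_mat x (0\<^sub>m m n) = 0\<^sub>m m n"
  by (intro eq_matI) (auto simp: eval_mat_def)

lemma eval_mat_smult: "eval_mat x (f \<cdot>\<^sub>m G) = f x \<cdot>\<^sub>m eval_mat x G"
  by (intro eq_matI) (auto simp: eval_mat_def)

lemma eval_mat_direct_sum:
  "eval_mat x (direct_sum_mat G H) = direct_sum_mat (eval_mat x G) (eval_mat x H)"
  by (intro eq_matI) (auto simp: eval_mat_def direct_sum_mat_def)

section \<open>Algebras of functions\<close>

lemma function_algebra_closed:
  assumes "function_algebra A"
  shows "const_fun c \<in> A" "0 \<in> A" "1 \<in> A"
    and "f \<in> A \<Longrightarrow> g \<in> A \<Longrightarrow> f + g \<in> A" "f \<in> A \<Longrightarrow> g \<in> A \<Longrightarrow> f * g \<in> A"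
    and "f \<in> A \<Longrightarrow> g \<in> A \<Longrightarrow> f - g \<in> A"
proof -
  have c: "const_fun c \<in> A" for c using assms by (simp add: function_algebra_def)
  show "const_fun c \<in> A" "0 \<in> A" "1 \<in> A" using c[of c] c[of 0] c[of 1] by simp_all
  show add: "f \<in> A \<Longrightarrow> g \<in> A \<Longrightarrow> f + g \<in> A" and mult: "f \<in> A \<Longrightarrow> g \<in> A \<Longrightarrow> f * g \<in> A" for f g
    using assms by (auto simp: function_algebra_def)
  have "f - g = f + const_fun (- 1) * g" by (simp add: fun_eq_iff)
  then show "f \<in> A \<Longrightarrow> g \<in> A \<Longrightarrow> f - g \<in> A" using add mult c by metis
qed

lemma function_algebra_sum:
  assumes "function_algebra A" "\<And>i. i \<in> I \<Longrightarrow> f i \<in> A"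
  shows "sum f I \<in> A"
  using assms(2) by (induction I rule: infinite_finite_induct)
    (auto intro: function_algebra_closed[OF assms(1)])

text \<open>Rectangular factors are allowed because a compression \<open>L * G * M\<close> has a
  rectangular intermediate product.\<close>

lemma function_algebra_mat_mult:
  assumes "function_algebra A" "G \<in> carrier_mat m n" "H \<in> carrier_mat n k"
    and "elements_mat G \<subseteq> A" "elements_mat H \<subseteq> A"
  shows "elements_mat (G * H) \<subseteq> A"
proof
  fix a assume "a \<in> elements_mat (G * H)"
  then obtain i j where ij: "i < m" "j < k" "a = (G * H) $$ (i, j)" using assms(2,3) by fastforce
  have "a = (\<Sum>l<n. G $$ (i, l) * H $$ (l, j))"
    using ij assms(2,3) by (auto simp: scalar_prod_def lessThan_atLeast0 intro!: sum.cong)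
  moreover have "G $$ (i, l) \<in> A" "H $$ (l, j) \<in> A" if "l < n" for l
    using that ij assms by (meson elements_matI subsetD)+
  ultimately show "a \<in> A"
    using assms(1) by (auto intro!: function_algebra_sum function_algebra_closed)
qed

lemma matrices_over_closed:
  assumes "function_algebra A" "G \<in> matrices_over n A"
  shows "0\<^sub>m n n \<in> matrices_over n A"
    and "H \<in> matrices_over n A \<Longrightarrow> G + H \<in> matrices_over n A"
    and "H \<in> matrices_over n A \<Longrightarrow> G - H \<in> matrices_over n A"
    and "H \<in> matrices_over n A \<Longrightarrow> G * H \<in> matrices_over n A"
    and "const_fun c \<cdot>\<^sub>m G \<in> matrices_over n A"
    and "H \<in> matrices_over k A \<Longrightarrow> direct_sum_mat G H \<in> matrices_over (n + k) A"
    and "L \<in> carrier_mat m n \<Longrightarrow> M \<in> carrier_mat n m \<Longrightarrow>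
      map_mat const_fun L * G * map_mat const_fun M \<in> matrices_over m A"
proof -
  note cl = function_algebra_closed[OF assms(1)]
  show "0\<^sub>m n n \<in> matrices_over n A" by (auto simp: matrices_over_def cl)
  show "H \<in> matrices_over n A \<Longrightarrow> G + H \<in> matrices_over n A"
    and "H \<in> matrices_over n A \<Longrightarrow> G - H \<in> matrices_over n A"
    and "const_fun c \<cdot>\<^sub>m G \<in> matrices_over n A"
    using assms(2) by (auto simp: matrices_over_def intro!: cl)
  show "H \<in> matrices_over k A \<Longrightarrow> direct_sum_mat G H \<in> matrices_over (n + k) A"
    using assms(2) by (auto simp: matrices_over_def direct_sum_mat_def intro!: cl)
  show "H \<in> matrices_over n A \<Longrightarrow> G * H \<in> matrices_over n A"
    using assms(2) function_algebra_mat_mult[OF assms(1)] unfolding matrices_over_iff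
    by (meson mult_carrier_mat)
  show "map_mat const_fun L * G * map_mat const_fun M \<in> matrices_over m A"
    if "L \<in> carrier_mat m n" "M \<in> carrier_mat n m"
  proof -
    have "elements_mat (map_mat const_fun K) \<subseteq> A" for K by (auto intro: cl)
    then show ?thesis
      using assms that unfolding matrices_over_iff
      by (meson function_algebra_mat_mult map_carrier_mat mult_carrier_mat)
  qed
qed

section \<open>Localization\<close>

text \<open>By definition of the quotient norms, \<open>local_norm A N G\<close> is the infimum of the \<open>C\<close> for which
  \<open>G \<in> M\<^sub>n(A)\<close> is interpolable. The predicate makes sense for all matrices of functions, which is
  what ties \<open>local_norm\<close> to \<open>bpw_norm\<close>.\<close>

definition interpolable ::
  "('x \<Rightarrow> complex) set \<Rightarrow> (('x \<Rightarrow> complex) mat \<Rightarrow> real) \<Rightarrow> real \<Rightarrow> ('x \<Rightarrow> complex) mat \<Rightarrow> bool" where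
  "interpolable A N C G \<longleftrightarrow> (\<forall>F. finite F \<longrightarrow>
     (\<exists>H \<in> matrices_over (dim_row G) A. N H \<le> C \<and> (\<forall>x\<in>F. eval_mat x H = eval_mat x G)))"

lemma interpolableI:
  assumes "G \<in> carrier_mat n n"
    and "\<And>F. finite F \<Longrightarrow>
      \<exists>H \<in> matrices_over n A. N H \<le> C \<and> (\<forall>x\<in>F. eval_mat x H = eval_mat x G)"
  shows "interpolable A N C G"
  using assms by (auto simp: interpolable_def)

lemma interpolableE:
  assumes "interpolable A N C G" "G \<in> carrier_mat n n" "finite F"
  obtains H where "H \<in> matrices_over n A" "N H \<le> C" "\<And>x. x \<in> F \<Longrightarrow> eval_mat x H = eval_mat x G"
  using assms by (auto simp: interpolable_def)

lemma interpolable_self: "G \<in> matrices_over n A \<Longrightarrow> N G \<le> C \<Longrightarrow> interpolable A N C G"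
  by (auto simp: interpolable_def matrices_over_def)

lemma matrices_over_vanishing_ideal_iff:
  "K \<in> matrices_over n (vanishing_ideal A F) \<longleftrightarrow>
    K \<in> matrices_over n A \<and> (\<forall>x\<in>F. eval_mat x K = 0\<^sub>m n n)"
proof (cases "K \<in> carrier_mat n n")
  case True
  have "eval_mat x K = 0\<^sub>m n n \<longleftrightarrow> (\<forall>i<n. \<forall>j<n. (K $$ (i, j)) x = 0)" for x
    using eval_mat_eq_iff[OF True zero_carrier_mat[of n n], of x]
    by (simp add: eval_mat_zero)
  then show ?thesis using True by (auto simp: matrices_over_def vanishing_ideal_def)
qed (auto simp: matrices_over_def)

text \<open>The two assumptions hold for \<open>A\<close> with \<open>N\<close> and also for the BPW
  limits with \<open>bpw_norm\<close>, so the comparison of local norms with interpolation constants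
  serves both algebras.\<close>

context
  fixes A :: "('x \<Rightarrow> complex) set" and N :: "('x \<Rightarrow> complex) mat \<Rightarrow> real" and n :: nat
  assumes algebra: "function_algebra A"
    and nonneg: "\<And>G. G \<in> matrices_over n A \<Longrightarrow> 0 \<le> N G"
begin

lemma quotient_norm_bdd_below:
  assumes "G \<in> matrices_over n A"
  shows "bdd_below ((\<lambda>K. N (G + K)) ` matrices_over (dim_row G) (vanishing_ideal A F))"
  using assms matrices_over_carrier[OF assms]
  by (intro bdd_belowI[of _ 0])
    (auto simp: matrices_over_vanishing_ideal_iff intro!: nonneg matrices_over_closed[OF algebra])

text \<open>The difference H - G vanishes on F, so H = G + (H - G) is a representative of the coset
  of G.\<close>

lemma quotient_norm_le:
  assumes G: "G \<in> matrices_over n A" and H: "H \<in> matrices_over n A"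
    and eq: "\<And>x. x \<in> F \<Longrightarrow> eval_mat x H = eval_mat x G"
  shows "quotient_norm A N F G \<le> N H"
proof -
  have dim: "dim_row G = n" "dim_col G = n" "dim_row H = n" "dim_col H = n"
    using matrices_over_carrier[OF G] matrices_over_carrier[OF H] by auto
  have "eval_mat x (H - G) = 0\<^sub>m n n" if "x \<in> F" for x
  proof -
    have "\<forall>i<n. \<forall>j<n. (H $$ (i, j)) x = (G $$ (i, j)) x"
      using eq[OF that] eval_mat_eq_iff[of H n n G x] matrices_over_carrier[OF G]
        matrices_over_carrier[OF H] by simp
    then show ?thesis by (intro eq_matI) (auto simp: eval_mat_def dim)
  qed
  then have mem: "H - G \<in> matrices_over (dim_row G) (vanishing_ideal A F)"
    using matrices_over_closed(3)[OF algebra H G]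
    by (auto simp: matrices_over_vanishing_ideal_iff dim)
  have "G + (H - G) = H" by (intro eq_matI) (auto simp: dim)
  then show ?thesis
    unfolding quotient_norm_def
    using cINF_lower[OF quotient_norm_bdd_below[OF G] mem] by simp
qed

lemma local_norm_le:
  assumes "G \<in> matrices_over n A" "interpolable A N C G"
  shows "local_norm A N G \<le> C"
  unfolding local_norm_def
proof (rule cSUP_least)
  fix F :: "'x set" assume "F \<in> {F. finite F}"
  then obtain H where "H \<in> matrices_over n A" "N H \<le> C" "\<And>x. x \<in> F \<Longrightarrow> eval_mat x H = eval_mat x G"
    using interpolableE[OF assms(2) matrices_over_carrier[OF assms(1)]] by blast
  then show "quotient_norm A N F G \<le> C"
    using quotient_norm_le[OF assms(1)] by (meson order_trans)
qed auto

text \<open>A representative of the coset agrees with G on F. The infimum over the coset need not be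
  attained, hence the strict inequality in the hypothesis.\<close>

lemma interpolable_if_local_norm_less:
  assumes G: "G \<in> matrices_over n A" and less: "local_norm A N G < C"
  shows "interpolable A N C G"
proof (rule interpolableI[OF matrices_over_carrier[OF G]])
  fix F :: "'x set" assume F: "finite F"
  note carr = matrices_over_carrier[OF G]
  have "quotient_norm A N F G \<le> local_norm A N G"
    unfolding local_norm_def
    \<comment> \<open>G represents its own coset for every F, so \<open>N G\<close> bounds all
      quotient norms and the supremum is a genuine one.\<close>
    by (intro cSUP_upper bdd_aboveI[of _ "N G"]) (use F quotient_norm_le[OF G G] in auto)
  with less have "quotient_norm A N F G < C" by simp
  moreover have "0\<^sub>m n n \<in> matrices_over n (vanishing_ideal A F)"
    using matrices_over_closed(1)[OF algebra G]
    by (auto simp: matrices_over_vanishing_ideal_iff)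
  ultimately obtain K where K: "K \<in> matrices_over n (vanishing_ideal A F)" "N (G + K) < C"
    using cINF_less_iff[OF _ quotient_norm_bdd_below[OF G], of F C] carrier_matD(1)[OF carr]
    unfolding quotient_norm_def by auto
  then have "K \<in> matrices_over n A" "\<And>x. x \<in> F \<Longrightarrow> eval_mat x K = 0\<^sub>m n n"
    by (auto simp: matrices_over_vanishing_ideal_iff)
  moreover have "eval_mat x (G + K) = eval_mat x G" if "x \<in> F" for x
    using eval_mat_add[OF carr, of K x] matrices_over_carrier[OF K(1)] calculation(2)[OF that] carr
    by (simp add: eval_mat_def)
  ultimately show "\<exists>H\<in>matrices_over n A. N H \<le> C \<and> (\<forall>x\<in>F. eval_mat x H = eval_mat x G)"
    using matrices_over_closed(2)[OF algebra G] K(2) by (intro bexI[of _ "G + K"]) auto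
qed

end

section \<open>BPW limits as uniformly interpolable functions\<close>

text \<open>The net takes at (F, k) an element that is within 1/(k+1) of the target on F. The
  parameter t stands for a matrix position; a one-point set of parameters gives the scalar
  case.\<close>

lemma net_index_approx:
  fixes u :: "'h \<Rightarrow> 't \<Rightarrow> 'x \<Rightarrow> complex"
  assumes "\<And>F e. finite F \<Longrightarrow> e > 0 \<Longrightarrow> \<exists>h\<in>S. \<forall>x\<in>F. \<forall>t\<in>T. dist (u h t x) (l t x) < e"
  shows "\<exists>(D :: 'x net_index set) rel H. directed D rel \<and> (\<forall>d\<in>D. H d \<in> S) \<and>
    (\<forall>x. \<forall>t\<in>T. net_converges D rel (\<lambda>d. u (H d) t x) (l t x))"
proof -
  let ?D = "{(F :: 'x set, k :: nat). finite F}"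
  have "\<exists>h. h \<in> S \<and> (\<forall>x\<in>fst d. \<forall>t\<in>T. dist (u h t x) (l t x) < inverse (real (Suc (snd d))))"
    if "d \<in> ?D" for d
    using assms[of "fst d" "inverse (real (Suc (snd d)))"] that by auto
  then obtain H where H: "\<And>d. d \<in> ?D \<Longrightarrow> H d \<in> S \<and>
      (\<forall>x\<in>fst d. \<forall>t\<in>T. dist (u (H d) t x) (l t x) < inverse (real (Suc (snd d))))"
    by metis
  have "net_converges ?D (\<lambda>(F, k) (F', k'). F \<subseteq> F' \<and> k \<le> k') (\<lambda>d. u (H d) t x) (l t x)"
    if "t \<in> T" for x t
  proof (rule net_index_converges)
    fix F :: "'x set" and k :: nat assume "finite F" "x \<in> F"
    then show "dist (u (H (F, k)) t x) (l t x) < inverse (real (Suc k))"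
      using H[of "(F, k)"] that by simp
  qed
  then show ?thesis using H directed_net_index by blast
qed

text \<open>A finite set of points and the finitely many entries impose finitely many eventual
  conditions, which by directedness hold together beyond one index.\<close>

lemma pointwise_mat_net_approx:
  assumes "pointwise_mat_net D rel H S G" "finite F" "e > 0"
  shows "\<exists>K\<in>S. \<forall>x\<in>F. \<forall>i<dim_row G. \<forall>j<dim_col G. dist ((K $$ (i, j)) x) ((G $$ (i, j)) x) < e"
proof -
  have dir: "directed D rel" using assms(1) by (simp add: pointwise_mat_net_def)
  have "\<exists>d\<in>D. \<forall>j\<in>D. rel d j \<longrightarrow> (\<forall>t \<in> F \<times> {..<dim_row G} \<times> {..<dim_col G}.
      dist ((H j $$ snd t) (fst t)) ((G $$ snd t) (fst t)) < e)"
    using assms by (intro net_eventually_all[OF dir]) (auto simp: pointwise_mat_net_def)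
  then obtain d where d: "d \<in> D" "\<forall>j\<in>D. rel d j \<longrightarrow> (\<forall>t \<in> F \<times> {..<dim_row G} \<times> {..<dim_col G}.
      dist ((H j $$ snd t) (fst t)) ((G $$ snd t) (fst t)) < e)" by blast
  moreover have "rel d d" using dir d(1) by (simp add: directed_def)
  moreover have "H d \<in> S" using assms(1) d(1) by (simp add: pointwise_mat_net_def)
  ultimately show ?thesis by (intro bexI[of _ "H d"]) auto
qed

text \<open>Removes nets from the norm: a bounded net with limit G exists exactly when G can be
  approximated on every finite set within the same bound.\<close>

lemma bpw_norm_eq_Inf_approx:
  "bpw_norm A N G = Inf {C. \<forall>F e. finite F \<longrightarrow> e > 0 \<longrightarrow>
     (\<exists>K \<in> matrices_over (dim_row G) A. N K \<le> C \<and>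
       (\<forall>x\<in>F. \<forall>i<dim_row G. \<forall>j<dim_col G. dist ((K $$ (i, j)) x) ((G $$ (i, j)) x) < e))}"
proof -
  have "(\<exists>(D :: 'a net_index set) rel H.
      pointwise_mat_net D rel H {K \<in> matrices_over (dim_row G) A. N K \<le> C} G) \<longleftrightarrow>
    (\<forall>F e. finite F \<longrightarrow> e > 0 \<longrightarrow> (\<exists>K \<in> matrices_over (dim_row G) A. N K \<le> C \<and>
       (\<forall>x\<in>F. \<forall>i<dim_row G. \<forall>j<dim_col G. dist ((K $$ (i, j)) x) ((G $$ (i, j)) x) < e)))"
    (is "?net \<longleftrightarrow> ?approx") for C
  proof
    assume ?net
    then show ?approx using pointwise_mat_net_approx by blast
  next
    assume a: ?approx
    let ?S = "{K \<in> matrices_over (dim_row G) A. N K \<le> C}"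
    have "\<exists>K\<in>?S. \<forall>x\<in>F. \<forall>t\<in>{..<dim_row G} \<times> {..<dim_col G}. dist ((K $$ t) x) ((G $$ t) x) < e"
      if "finite F" "e > 0" for F e
    proof -
      from a[rule_format, OF that] obtain K where "K \<in> matrices_over (dim_row G) A" "N K \<le> C"
        "\<forall>x\<in>F. \<forall>i<dim_row G. \<forall>j<dim_col G. dist ((K $$ (i, j)) x) ((G $$ (i, j)) x) < e"
        by blast
      then show ?thesis by (intro bexI[of _ K]) auto
    qed
    from net_index_approx[where u = "\<lambda>K t. K $$ t" and l = "\<lambda>t. G $$ t", OF this]
    show ?net unfolding pointwise_mat_net_def by simp blast
  qed
  then show ?thesis by (simp add: bpw_norm_def)
qed

lemma bpw_limits_iff_approx:
  "f \<in> bpw_limits S N \<longleftrightarrow> (\<exists>C. \<forall>F e. finite F \<longrightarrow> e > 0 \<longrightarrow>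
     (\<exists>g\<in>S. N (mat1 g) \<le> C \<and> (\<forall>x\<in>F. dist (g x) (f x) < e)))"
proof
  assume "f \<in> bpw_limits S N"
  then obtain D :: "'a net_index set" and rel h C
    where net: "pointwise_net D rel h {g \<in> S. N (mat1 g) \<le> C} f"
    by (auto simp: bpw_limits_def)
  \<comment> \<open>Read as a net of 1 by 1 matrices, the scalar net falls under the matrix
    lemma.\<close>
  then have net': "pointwise_mat_net D rel (\<lambda>d. mat1 (h d)) (mat1 ` {g \<in> S. N (mat1 g) \<le> C}) (mat1 f)"
    by (auto simp: pointwise_net_def pointwise_mat_net_def)
  show "\<exists>C. \<forall>F e. finite F \<longrightarrow> e > 0 \<longrightarrow> (\<exists>g\<in>S. N (mat1 g) \<le> C \<and> (\<forall>x\<in>F. dist (g x) (f x) < e))"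
    using pointwise_mat_net_approx[OF net'] by (intro exI[of _ C]) fastforce
next
  assume "\<exists>C. \<forall>F e. finite F \<longrightarrow> e > 0 \<longrightarrow> (\<exists>g\<in>S. N (mat1 g) \<le> C \<and> (\<forall>x\<in>F. dist (g x) (f x) < e))"
  then obtain C where C: "finite F \<Longrightarrow> e > 0 \<Longrightarrow>
      \<exists>g\<in>S. N (mat1 g) \<le> C \<and> (\<forall>x\<in>F. dist (g x) (f x) < e)" for F e
    by meson
  have "\<exists>g\<in>{g \<in> S. N (mat1 g) \<le> C}. \<forall>x\<in>F. \<forall>t\<in>{()}. dist (g x) (f x) < e"
    if "finite F" "e > 0" for F e
    using C[OF that] by auto
  from net_index_approx[where u = "\<lambda>g t. g" and l = "\<lambda>t. f", OF this]
  show "f \<in> bpw_limits S N"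
    unfolding bpw_limits_def pointwise_net_def by simp blast
qed

text \<open>Selecting by index functions covers single entries (m = 1, constant functions) as well
  as both diagonal blocks of a direct sum (identity and shift).\<close>

definition submat :: "nat \<Rightarrow> (nat \<Rightarrow> nat) \<Rightarrow> (nat \<Rightarrow> nat) \<Rightarrow> 'a mat \<Rightarrow> 'a mat" where
  "submat m \<sigma> \<tau> G = mat m m (\<lambda>(i, j). G $$ (\<sigma> i, \<tau> j))"

lemma submat_carrier [simp]: "submat m \<sigma> \<tau> G \<in> carrier_mat m m"
  by (simp add: submat_def)

lemma eval_mat_submat:
  assumes "G \<in> carrier_mat n n" "\<sigma> ` {..<m} \<subseteq> {..<n}" "\<tau> ` {..<m} \<subseteq> {..<n}"
  shows "eval_mat x (submat m \<sigma> \<tau> G) = submat m \<sigma> \<tau> (eval_mat x G)"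
  using assms by (intro eq_matI) (auto simp: eval_mat_def submat_def image_subset_iff)

lemma submat_mem_matrices_over:
  assumes "G \<in> matrices_over n S" "\<sigma> ` {..<m} \<subseteq> {..<n}" "\<tau> ` {..<m} \<subseteq> {..<n}"
  shows "submat m \<sigma> \<tau> G \<in> matrices_over m S"
  using assms by (auto simp: matrices_over_def submat_def)

lemma submat_direct_sum:
  assumes "G \<in> carrier_mat m m" "H \<in> carrier_mat n n"
  shows "submat m (\<lambda>i. i) (\<lambda>i. i) (direct_sum_mat G H) = G"
    and "submat n (\<lambda>i. m + i) (\<lambda>i. m + i) (direct_sum_mat G H) = H"
  using assms by (auto simp: submat_def direct_sum_mat_def intro!: eq_matI)

locale function_operator_algebra =
  fixes A :: "('x \<Rightarrow> complex) set" and N :: "('x \<Rightarrow> complex) mat \<Rightarrow> real"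
  assumes operator_algebra: "operator_algebra_of_functions A N"
begin

lemma algebra: "function_algebra A"
  and separating: "x \<noteq> y \<Longrightarrow> \<exists>f\<in>A. f x \<noteq> f y"
  and eval_bounded: "\<exists>K. \<forall>f\<in>A. cmod (f x) \<le> K * N (mat1 f)"
  using operator_algebra by (auto simp: operator_algebra_of_functions_def)

lemma
  assumes "0 < n"
  shows norm_nonneg: "G \<in> matrices_over n A \<Longrightarrow> 0 \<le> N G"
    and norm_zero: "N (0\<^sub>m n n) = 0"
    and norm_smult: "G \<in> matrices_over n A \<Longrightarrow> N (const_fun c \<cdot>\<^sub>m G) = cmod c * N G"
    and norm_triangle: "G \<in> matrices_over n A \<Longrightarrow> H \<in> matrices_over n A \<Longrightarrow> N (G + H) \<le> N G + N H"
proof -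
  have "norm_on_matrices n A N"
    using operator_algebra assms by (simp add: operator_algebra_of_functions_def)
  moreover have "0\<^sub>m n n \<in> matrices_over n A"
    by (auto simp: matrices_over_def function_algebra_closed[OF algebra])
  ultimately show "G \<in> matrices_over n A \<Longrightarrow> 0 \<le> N G" "N (0\<^sub>m n n) = 0"
    "G \<in> matrices_over n A \<Longrightarrow> N (const_fun c \<cdot>\<^sub>m G) = cmod c * N G"
    "G \<in> matrices_over n A \<Longrightarrow> H \<in> matrices_over n A \<Longrightarrow> N (G + H) \<le> N G + N H"
    unfolding norm_on_matrices_def by blast+
qed

lemma norm_compress:
  assumes "0 < m" "0 < n" "L \<in> carrier_mat m n" "G \<in> matrices_over n A" "M \<in> carrier_mat n m"
  shows "N (map_mat const_fun L * G * map_mat const_fun M) \<le> op_norm_mat L * N G * op_norm_mat M"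
  using operator_algebra assms
  by (auto simp: operator_algebra_of_functions_def BRS_axioms_def)

lemma norm_direct_sum:
  "0 < m \<Longrightarrow> 0 < n \<Longrightarrow> G \<in> matrices_over m A \<Longrightarrow> H \<in> matrices_over n A \<Longrightarrow>
    N (direct_sum_mat G H) = max (N G) (N H)"
  using operator_algebra by (auto simp: operator_algebra_of_functions_def BRS_axioms_def)

lemma norm_mult:
  "0 < n \<Longrightarrow> G \<in> matrices_over n A \<Longrightarrow> H \<in> matrices_over n A \<Longrightarrow> N (G * H) \<le> N G * N H"
  using operator_algebra by (auto simp: operator_algebra_of_functions_def BRS_axioms_def)

lemma norm_one: "N (mat1 1) = 1"
  using operator_algebra by (auto simp: operator_algebra_of_functions_def BRS_axioms_def)

section \<open>Comparing the norm of a matrix with the norms of its entries\<close>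

lemma norm_submat_le:
  assumes "0 < m" "0 < n" and G: "G \<in> matrices_over n A"
    and "inj_on \<sigma> {..<m}" and \<sigma>: "\<sigma> ` {..<m} \<subseteq> {..<n}"
    and "inj_on \<tau> {..<m}" and \<tau>: "\<tau> ` {..<m} \<subseteq> {..<n}"
  shows "N (submat m \<sigma> \<tau> G) \<le> N G"
proof -
  let ?L = "select_mat m n \<sigma> :: complex mat" and ?M = "(select_mat m n \<tau>)\<^sup>T :: complex mat"
  have "map_mat const_fun ?L = (select_mat m n \<sigma> :: ('x \<Rightarrow> complex) mat)"
    and "map_mat const_fun ?M = ((select_mat m n \<tau>)\<^sup>T :: ('x \<Rightarrow> complex) mat)"
    by (auto simp: select_mat_def intro!: eq_matI)
  then have "map_mat const_fun ?L * G * map_mat const_fun ?M = submat m \<sigma> \<tau> G"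
    using select_mat_mult[OF matrices_over_carrier[OF G] \<sigma> \<tau>] by (simp add: submat_def)
  then have "N (submat m \<sigma> \<tau> G) \<le> op_norm_mat ?L * N G * op_norm_mat ?M"
    using norm_compress[OF assms(1,2) _ G, of ?L ?M] by simp
  also have "\<dots> \<le> 1 * N G * 1"
    using assms op_norm_select_mat_le_one op_norm_select_mat_transpose_le_one
    by (intro mult_mono op_norm_mat_nonneg mult_nonneg_nonneg norm_nonneg[OF assms(2) G]) auto
  finally show ?thesis by simp
qed

lemma norm_entry_le:
  assumes "0 < n" "G \<in> matrices_over n A" "i < n" "j < n"
  shows "N (mat1 (G $$ (i, j))) \<le> N G"
proof -
  have "submat 1 (\<lambda>_. i) (\<lambda>_. j) G = mat1 (G $$ (i, j))"
    by (intro eq_matI) (auto simp: submat_def)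
  then show ?thesis
    using norm_submat_le[of 1 n G "\<lambda>_. i" "\<lambda>_. j"] assms by (auto simp: inj_on_def)
qed

text \<open>The matrix with the single entry f is a scalar column times \<open>mat1 f\<close> times
  a scalar row, so the rectangular form of the first BRS axiom applies. What matters about the
  constant is that it does not depend on f.\<close>

lemma norm_matrix_unit_le:
  assumes "0 < n" "i < n" "j < n"
  obtains K where "0 \<le> K"
    "\<And>f. f \<in> A \<Longrightarrow> N (mat n n (\<lambda>p. if p = (i, j) then f else 0)) \<le> K * N (mat1 f)"
proof
  let ?L = "mat n 1 (\<lambda>(k, _). if k = i then 1 else 0) :: complex mat"
  let ?M = "mat 1 n (\<lambda>(_, k). if k = j then 1 else 0) :: complex mat"
  show "0 \<le> op_norm_mat ?L * op_norm_mat ?M" by (simp add: op_norm_mat_nonneg)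
  fix f assume f: "f \<in> A"
  have "mat n n (\<lambda>p. if p = (i, j) then f else 0) = map_mat const_fun ?L * mat1 f * map_mat const_fun ?M"
    by (intro eq_matI) (auto simp: scalar_prod_def mat1_def)
  also have "N \<dots> \<le> op_norm_mat ?L * N (mat1 f) * op_norm_mat ?M"
    using f assms by (intro norm_compress[of n 1]) auto
  finally show "N (mat n n (\<lambda>p. if p = (i, j) then f else 0)) \<le>
      op_norm_mat ?L * op_norm_mat ?M * N (mat1 f)"
    by (simp add: mult_ac)
qed

text \<open>A matrix is the sum of its one-entry pieces, so the triangle inequality gives a constant
  that is the sum of the constants for the single positions.\<close>

lemma norm_le_entries:
  assumes "0 < n"
  obtains K where "0 \<le> K"
    "\<And>G b. G \<in> matrices_over n A \<Longrightarrow> (\<And>i j. i < n \<Longrightarrow> j < n \<Longrightarrow> N (mat1 (G $$ (i, j))) \<le> b) \<Longrightarrow>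
      N G \<le> K * b"
proof -
  \<comment> \<open>The induction runs over the set S of positions that are kept, all other entries
    being replaced by zero; K is chosen before G and b.\<close>
  have "\<exists>K\<ge>0. \<forall>G\<in>matrices_over n A. \<forall>b. (\<forall>p\<in>S. N (mat1 (G $$ p)) \<le> b) \<longrightarrow>
      N (mat n n (\<lambda>p. if p \<in> S then G $$ p else 0)) \<le> K * b"
    if "finite S" "S \<subseteq> {..<n} \<times> {..<n}" for S
    using that
  proof (induction S)
    case empty
    have "mat n n (\<lambda>_. 0) = (0\<^sub>m n n :: ('x \<Rightarrow> complex) mat)"
      by (intro eq_matI) auto
    then have "N (mat n n (\<lambda>_. 0)) = 0" by (simp only: norm_zero[OF assms])
    then show ?case by (intro exI[of _ 0]) (simp add: zero_fun_def)
  next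
    case (insert q S)
    obtain i j where q: "q = (i, j)" "i < n" "j < n" using insert.prems by auto
    obtain K where K: "0 \<le> K" "\<And>G b. G \<in> matrices_over n A \<Longrightarrow> \<forall>p\<in>S. N (mat1 (G $$ p)) \<le> b \<Longrightarrow>
        N (mat n n (\<lambda>p. if p \<in> S then G $$ p else 0)) \<le> K * b"
      using insert by (meson subset_insertI order_trans)
    obtain K' where K': "0 \<le> K'"
      "\<And>f. f \<in> A \<Longrightarrow> N (mat n n (\<lambda>p. if p = (i, j) then f else 0)) \<le> K' * N (mat1 f)"
      using norm_matrix_unit_le[OF assms q(2,3)] by blast
    have "N (mat n n (\<lambda>p. if p \<in> insert q S then G $$ p else 0)) \<le> (K + K') * b"
      if G: "G \<in> matrices_over n A" and b: "\<forall>p\<in>insert q S. N (mat1 (G $$ p)) \<le> b" for G b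
    proof -
      let ?R = "mat n n (\<lambda>p. if p \<in> S then G $$ p else 0)"
      let ?E = "mat n n (\<lambda>p. if p = (i, j) then G $$ q else 0)"
      have Gq: "G $$ q \<in> A" using G q by (auto simp: matrices_over_def)
      have "?R \<in> matrices_over n A" "?E \<in> matrices_over n A"
        using G Gq by (auto simp: matrices_over_def function_algebra_closed[OF algebra])
      then have "N (?R + ?E) \<le> N ?R + N ?E" by (rule norm_triangle[OF assms])
      also have "mat n n (\<lambda>p. if p \<in> insert q S then G $$ p else 0) = ?R + ?E"
        using insert.hyps q(1) by (intro eq_matI) auto
      moreover have "N ?R \<le> K * b" using K(2)[OF G] b by simp
      moreover have "N ?E \<le> K' * b"
        using K'(2)[OF Gq] b mult_left_mono[OF _ K'(1), of "N (mat1 (G $$ q))" b] by simp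
      ultimately show ?thesis by (simp add: distrib_right)
    qed
    then show ?case using K(1) K'(1) by (intro exI[of _ "K + K'"]) auto
  qed
  from this[of "{..<n} \<times> {..<n}"] obtain K where K: "0 \<le> K"
    "\<And>G b. G \<in> matrices_over n A \<Longrightarrow> \<forall>p\<in>{..<n} \<times> {..<n}. N (mat1 (G $$ p)) \<le> b \<Longrightarrow>
      N (mat n n (\<lambda>p. if p \<in> {..<n} \<times> {..<n} then G $$ p else 0)) \<le> K * b"
    by (auto simp del: mem_Sigma_iff)
  have "mat n n (\<lambda>p. if p \<in> {..<n} \<times> {..<n} then G $$ p else 0) = G"
    if "G \<in> carrier_mat n n" for G :: "('x \<Rightarrow> complex) mat"
    using that by (intro eq_matI) auto
  with K show ?thesis using that[OF K(1)] by (metis (no_types, lifting) SigmaE lessThan_iff matrices_over_carrier)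
qed

section \<open>Interpolation on finite sets with control of the norm\<close>

text \<open>As in Lagrange interpolation, p is a product of factors (f - f(y)) / (f(x) - f(y)),
  where f separates x from y.\<close>

lemma peak_function:
  assumes "finite F" "x \<notin> F"
  shows "\<exists>p\<in>A. p x = 1 \<and> (\<forall>y\<in>F. p y = 0)"
  using assms
proof (induction F)
  case empty
  then show ?case by (intro bexI[of _ 1]) (auto simp: function_algebra_closed[OF algebra])
next
  case (insert y F)
  then obtain p where p: "p \<in> A" "p x = 1" "\<forall>y\<in>F. p y = 0" by auto
  obtain f where f: "f \<in> A" "f x \<noteq> f y" using separating[of x y] insert.prems by auto
  let ?q = "p * (const_fun (1 / (f x - f y)) * (f - const_fun (f y)))"
  have "?q \<in> A" using p f by (intro function_algebra_closed[OF algebra]) auto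
  moreover have "?q x = 1" "\<forall>z\<in>insert y F. ?q z = 0" using p f by auto
  ultimately show ?case by blast
qed

text \<open>The point of the statement is that K depends on F alone and not on the prescribed
  values. At a new point y the old interpolant a is repaired by a multiple of a function that is 1
  at y and 0 on F; boundedness of evaluation at y controls how large that multiple is.\<close>

lemma finite_interpolation:
  assumes "finite F"
  shows "\<exists>K\<ge>0. \<forall>f e. 0 \<le> e \<longrightarrow> (\<forall>x\<in>F. cmod (f x) \<le> e) \<longrightarrow>
    (\<exists>a\<in>A. (\<forall>x\<in>F. a x = f x) \<and> N (mat1 a) \<le> K * e)"
  using assms
proof (induction F)
  case empty
  have "mat1 (0 :: 'x \<Rightarrow> complex) = 0\<^sub>m 1 1" by (intro eq_matI) (auto simp: mat1_def)
  then have "N (mat1 0) = 0" by (simp add: norm_zero)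
  then show ?case
    by (intro exI[of _ 0]) (auto intro!: bexI[of _ 0] function_algebra_closed[OF algebra])
next
  case (insert y F)
  then obtain K where K: "0 \<le> K" "\<And>f e. 0 \<le> e \<Longrightarrow> \<forall>x\<in>F. cmod (f x) \<le> e \<Longrightarrow>
      \<exists>a\<in>A. (\<forall>x\<in>F. a x = f x) \<and> N (mat1 a) \<le> K * e" by blast
  obtain p where p: "p \<in> A" "p y = 1" "\<forall>x\<in>F. p x = 0"
    using peak_function[OF insert.hyps(1,2)] by blast
  obtain M where M: "\<forall>f\<in>A. cmod (f y) \<le> M * N (mat1 f)" using eval_bounded by blast
  have Np: "0 \<le> N (mat1 p)" using p by (intro norm_nonneg[of 1]) auto
  \<comment> \<open>The interpolant on F costs K times e, and the coefficient c = f(y) - a(y)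
    satisfies |c| \<le> e + |M| K e.\<close>
  let ?K = "K + (1 + \<bar>M\<bar> * K) * N (mat1 p)"
  have "\<exists>a\<in>A. (\<forall>x\<in>insert y F. a x = f x) \<and> N (mat1 a) \<le> ?K * e"
    if e: "0 \<le> e" and f: "\<forall>x\<in>insert y F. cmod (f x) \<le> e" for f e
  proof -
    obtain a where a: "a \<in> A" "\<forall>x\<in>F. a x = f x" "N (mat1 a) \<le> K * e" using K(2)[OF e] f by blast
    let ?c = "f y - a y"
    let ?b = "a + const_fun ?c * p"
    have Na: "0 \<le> N (mat1 a)" using a by (intro norm_nonneg[of 1]) auto
    have "cmod (a y) \<le> \<bar>M\<bar> * N (mat1 a)"
      using M a(1) Na by (meson abs_ge_self mult_right_mono order_trans)
    also have "\<dots> \<le> \<bar>M\<bar> * (K * e)" using a(3) by (intro mult_left_mono) auto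
    finally have "cmod ?c \<le> (1 + \<bar>M\<bar> * K) * e"
      using norm_triangle_ineq4[of "f y" "a y"] f by (simp add: algebra_simps)
    then have "cmod ?c * N (mat1 p) \<le> (1 + \<bar>M\<bar> * K) * e * N (mat1 p)"
      by (rule mult_right_mono[OF _ Np])
    moreover have "N (mat1 ?b) \<le> N (mat1 a) + cmod ?c * N (mat1 p)"
    proof -
      have "mat1 ?b = mat1 a + const_fun ?c \<cdot>\<^sub>m mat1 p" by (intro eq_matI) (auto simp: mat1_def)
      moreover have "mat1 a \<in> matrices_over 1 A" "mat1 p \<in> matrices_over 1 A" using a p by auto
      ultimately show ?thesis
        using norm_triangle[of 1 "mat1 a" "const_fun ?c \<cdot>\<^sub>m mat1 p"] norm_smult[of 1 "mat1 p" ?c]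
          matrices_over_closed(5)[OF algebra, of "mat1 p" 1 ?c] by simp
    qed
    ultimately have "N (mat1 ?b) \<le> ?K * e" using a(3) by (simp add: algebra_simps)
    moreover have "?b \<in> A" using a p by (intro function_algebra_closed[OF algebra]) auto
    moreover have "\<forall>x\<in>insert y F. ?b x = f x" using a p by auto
    ultimately show ?thesis by blast
  qed
  then show ?case using K(1) Np by (intro exI[of _ ?K]) auto
qed

lemma finite_matrix_interpolation:
  assumes "0 < n" "finite F"
  obtains K where "0 \<le> K" "\<And>G e. 0 \<le> e \<Longrightarrow> G \<in> carrier_mat n n \<Longrightarrow>
      (\<And>x i j. x \<in> F \<Longrightarrow> i < n \<Longrightarrow> j < n \<Longrightarrow> cmod ((G $$ (i, j)) x) \<le> e) \<Longrightarrow>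
      \<exists>H\<in>matrices_over n A. (\<forall>x\<in>F. eval_mat x H = eval_mat x G) \<and> N H \<le> K * e"
proof -
  obtain K where K: "0 \<le> K" "\<And>f e. 0 \<le> e \<Longrightarrow> \<forall>x\<in>F. cmod (f x) \<le> e \<Longrightarrow>
      \<exists>a\<in>A. (\<forall>x\<in>F. a x = f x) \<and> N (mat1 a) \<le> K * e"
    using finite_interpolation[OF assms(2)] by blast
  obtain K' where K': "0 \<le> K'" "\<And>G b. G \<in> matrices_over n A \<Longrightarrow>
      (\<And>i j. i < n \<Longrightarrow> j < n \<Longrightarrow> N (mat1 (G $$ (i, j))) \<le> b) \<Longrightarrow> N G \<le> K' * b"
    using norm_le_entries[OF assms(1)] by blast
  have "\<exists>H\<in>matrices_over n A. (\<forall>x\<in>F. eval_mat x H = eval_mat x G) \<and> N H \<le> (K' * K) * e"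
    if e: "0 \<le> e" and G: "G \<in> carrier_mat n n"
      and le: "\<And>x i j. x \<in> F \<Longrightarrow> i < n \<Longrightarrow> j < n \<Longrightarrow> cmod ((G $$ (i, j)) x) \<le> e" for G e
  proof -
    have "\<exists>a\<in>A. (\<forall>x\<in>F. a x = (G $$ p) x) \<and> N (mat1 a) \<le> K * e"
      if "p \<in> {..<n} \<times> {..<n}" for p
      using that le by (intro K(2)[OF e]) auto
    then obtain h where h: "\<And>p. p \<in> {..<n} \<times> {..<n} \<Longrightarrow>
        h p \<in> A \<and> (\<forall>x\<in>F. h p x = (G $$ p) x) \<and> N (mat1 (h p)) \<le> K * e" by metis
    have mem: "mat n n h \<in> matrices_over n A" using h by (auto simp: matrices_over_def)
    moreover have "N (mat n n h) \<le> K' * (K * e)" by (intro K'(2)[OF mem]) (use h in auto)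
    moreover have "eval_mat x (mat n n h) = eval_mat x G" if "x \<in> F" for x
      using h that by (subst eval_mat_eq_iff[OF _ G]) auto
    ultimately show ?thesis by (intro bexI[of _ "mat n n h"]) (auto simp: mult_ac)
  qed
  then show ?thesis using that[of "K' * K"] K(1) K'(1) by auto
qed

text \<open>This turns approximation into exact agreement. A good approximant H is corrected by an
  interpolant of the error G - H, whose norm is small because the error is small on F; the error
  itself need not have entries in \<open>A\<close>.\<close>

lemma interpolable_if_approx:
  assumes "0 < n" and G: "G \<in> carrier_mat n n" and "C < D"
    and approx: "\<And>F e. finite F \<Longrightarrow> e > 0 \<Longrightarrow> \<exists>H\<in>matrices_over n A. N H \<le> C \<and>
      (\<forall>x\<in>F. \<forall>i<n. \<forall>j<n. dist ((H $$ (i, j)) x) ((G $$ (i, j)) x) < e)"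
  shows "interpolable A N D G"
proof (rule interpolableI[OF G])
  fix F :: "'x set" assume F: "finite F"
  obtain K where K: "0 \<le> K" "\<And>G e. 0 \<le> e \<Longrightarrow> G \<in> carrier_mat n n \<Longrightarrow>
      (\<And>x i j. x \<in> F \<Longrightarrow> i < n \<Longrightarrow> j < n \<Longrightarrow> cmod ((G $$ (i, j)) x) \<le> e) \<Longrightarrow>
      \<exists>H\<in>matrices_over n A. (\<forall>x\<in>F. eval_mat x H = eval_mat x G) \<and> N H \<le> K * e"
    using finite_matrix_interpolation[OF assms(1) F] by blast
  \<comment> \<open>The tolerance is chosen after K, so that the correction costs at most D - C. The
    summand 1 keeps the denominator positive when K = 0.\<close>
  define e where "e = (D - C) / (K + 1)"
  have e: "e > 0" "K * e \<le> D - C"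
    using K(1) \<open>C < D\<close> by (auto simp: e_def field_simps)
  obtain H where H: "H \<in> matrices_over n A" "N H \<le> C"
    "\<And>x i j. x \<in> F \<Longrightarrow> i < n \<Longrightarrow> j < n \<Longrightarrow> dist ((H $$ (i, j)) x) ((G $$ (i, j)) x) < e"
    using approx[OF F e(1)] by blast
  have H_dim: "dim_row H = n" "dim_col H = n" using matrices_over_carrier[OF H(1)] by auto
  have "\<exists>H'\<in>matrices_over n A. (\<forall>x\<in>F. eval_mat x H' = eval_mat x (G - H)) \<and> N H' \<le> K * e"
  proof (intro K(2))
    fix x i j assume "x \<in> F" "i < n" "j < n"
    then show "cmod (((G - H) $$ (i, j)) x) \<le> e"
      using H(3)[of x i j] H_dim by (simp add: dist_norm norm_minus_commute)
  qed (use e H_dim in auto)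
  then obtain H' where H': "H' \<in> matrices_over n A" "N H' \<le> K * e"
    "\<And>x. x \<in> F \<Longrightarrow> eval_mat x H' = eval_mat x (G - H)" by blast
  have "eval_mat x (H + H') = eval_mat x G" if "x \<in> F" for x
  proof -
    have "eval_mat x (H + H') = eval_mat x H + eval_mat x (G - H)"
      using H'(3)[OF that] eval_mat_add matrices_over_carrier H(1) H'(1) by metis
    also have "\<dots> = eval_mat x G" using G H_dim by (intro eq_matI) (auto simp: eval_mat_def)
    finally show ?thesis .
  qed
  moreover have "N (H + H') \<le> D" using norm_triangle[OF assms(1) H(1) H'(1)] H(2) H'(2) e by simp
  ultimately show "\<exists>H\<in>matrices_over n A. N H \<le> D \<and> (\<forall>x\<in>F. eval_mat x H = eval_mat x G)"
    using matrices_over_closed(2)[OF algebra H(1) H'(1)] by blast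
qed

lemma approx_if_interpolable:
  assumes "interpolable A N C G" "G \<in> carrier_mat n n" "finite F" "e > 0"
  shows "\<exists>H\<in>matrices_over n A. N H \<le> C \<and>
      (\<forall>x\<in>F. \<forall>i<n. \<forall>j<n. dist ((H $$ (i, j)) x) ((G $$ (i, j)) x) < e)"
proof -
  obtain H where H: "H \<in> matrices_over n A" "N H \<le> C" "\<And>x. x \<in> F \<Longrightarrow> eval_mat x H = eval_mat x G"
    using interpolableE[OF assms(1-3)] by blast
  then have "(H $$ (i, j)) x = (G $$ (i, j)) x" if "x \<in> F" "i < n" "j < n" for x i j
    using eval_mat_eq_iff[OF matrices_over_carrier[OF H(1)] assms(2)] that by blast
  then show ?thesis using H(1,2) \<open>e > 0\<close> by (intro bexI[of _ H]) auto
qed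

section \<open>The BPW norm as an infimum of interpolation constants\<close>

definition approx_bounds :: "nat \<Rightarrow> ('x \<Rightarrow> complex) mat \<Rightarrow> real set" where
  "approx_bounds n G = {C. \<forall>F e. finite F \<longrightarrow> e > 0 \<longrightarrow> (\<exists>H\<in>matrices_over n A. N H \<le> C \<and>
      (\<forall>x\<in>F. \<forall>i<n. \<forall>j<n. dist ((H $$ (i, j)) x) ((G $$ (i, j)) x) < e))}"

lemma bpw_norm_eq: "G \<in> carrier_mat n n \<Longrightarrow> bpw_norm A N G = Inf (approx_bounds n G)"
  unfolding bpw_norm_eq_Inf_approx approx_bounds_def carrier_mat_def by simp

lemma approx_bounds_if_interpolable:
  "interpolable A N C G \<Longrightarrow> G \<in> carrier_mat n n \<Longrightarrow> C \<in> approx_bounds n G"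
  unfolding approx_bounds_def mem_Collect_eq by (intro allI impI approx_if_interpolable)

lemma interpolable_nonneg:
  assumes "0 < n" "interpolable A N C G" "G \<in> carrier_mat n n"
  shows "0 \<le> C"
proof -
  obtain H where "H \<in> matrices_over n A" "N H \<le> C"
    using interpolableE[OF assms(2,3) finite.emptyI] by blast
  then show ?thesis using norm_nonneg[OF assms(1)] order_trans by blast
qed

lemma bpw_norm_le:
  assumes "0 < n" "G \<in> carrier_mat n n" "interpolable A N C G"
  shows "bpw_norm A N G \<le> C"
  unfolding bpw_norm_eq[OF assms(2)]
proof (rule cInf_lower)
  show "C \<in> approx_bounds n G" by (rule approx_bounds_if_interpolable[OF assms(3,2)])
  show "bdd_below (approx_bounds n G)"
  proof (rule bdd_belowI[of _ 0])
    fix C assume C: "C \<in> approx_bounds n G"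
    \<comment> \<open>The empty set of points already provides an element of norm at most C, so C is
      nonnegative.\<close>
    have "\<exists>H\<in>matrices_over n A. N H \<le> C"
      using C[unfolded approx_bounds_def mem_Collect_eq, rule_format, of "{}" 1] by auto
    then show "0 \<le> C" using norm_nonneg[OF assms(1)] order_trans by blast
  qed
qed

text \<open>Some approximation bound C' lies below C, and the gap pays for making the agreement
  exact. The given constant \<open>C\<^sub>0\<close> shows that the infimum is taken over a nonempty
  set.\<close>

lemma interpolable_if_bpw_norm_less:
  assumes "0 < n" "G \<in> carrier_mat n n" "interpolable A N C\<^sub>0 G" "bpw_norm A N G < C"
  shows "interpolable A N C G"
proof -
  have "approx_bounds n G \<noteq> {}" using approx_bounds_if_interpolable[OF assms(3,2)] by blast
  moreover have "Inf (approx_bounds n G) < C" using assms(4) by (simp only: bpw_norm_eq[OF assms(2)])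
  ultimately obtain C' where C': "C' \<in> approx_bounds n G" "C' < C"
    using cInf_lessD by meson
  show ?thesis
    by (rule interpolable_if_approx[OF assms(1,2) C'(2)])
      (use C'(1) in \<open>simp add: approx_bounds_def\<close>)
qed

section \<open>Stability of interpolability under the matrix operations\<close>

lemma interpolable_add:
  assumes "0 < n" "G \<in> carrier_mat n n" "H \<in> carrier_mat n n"
    "interpolable A N C G" "interpolable A N D H"
  shows "interpolable A N (C + D) (G + H)"
proof (rule interpolableI)
  fix F :: "'x set" assume F: "finite F"
  obtain G' where G': "G' \<in> matrices_over n A" "N G' \<le> C"
    "\<And>x. x \<in> F \<Longrightarrow> eval_mat x G' = eval_mat x G"
    using interpolableE[OF assms(4,2) F] by blast
  obtain H' where H': "H' \<in> matrices_over n A" "N H' \<le> D"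
    "\<And>x. x \<in> F \<Longrightarrow> eval_mat x H' = eval_mat x H"
    using interpolableE[OF assms(5,3) F] by blast
  have "N (G' + H') \<le> C + D" using norm_triangle[OF assms(1) G'(1) H'(1)] G'(2) H'(2) by simp
  moreover have "\<forall>x\<in>F. eval_mat x (G' + H') = eval_mat x (G + H)"
    using G' H' assms(2,3) by (simp add: eval_mat_add[of _ n n] matrices_over_carrier)
  ultimately show "\<exists>K\<in>matrices_over n A. N K \<le> C + D \<and> (\<forall>x\<in>F. eval_mat x K = eval_mat x (G + H))"
    using matrices_over_closed(2)[OF algebra G'(1) H'(1)] by blast
qed (use assms in simp)

lemma interpolable_mult:
  assumes "0 < n" "G \<in> carrier_mat n n" "H \<in> carrier_mat n n"
    "interpolable A N C G" "interpolable A N D H"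
  shows "interpolable A N (C * D) (G * H)"
proof (rule interpolableI)
  fix F :: "'x set" assume F: "finite F"
  obtain G' where G': "G' \<in> matrices_over n A" "N G' \<le> C"
    "\<And>x. x \<in> F \<Longrightarrow> eval_mat x G' = eval_mat x G"
    using interpolableE[OF assms(4,2) F] by blast
  obtain H' where H': "H' \<in> matrices_over n A" "N H' \<le> D"
    "\<And>x. x \<in> F \<Longrightarrow> eval_mat x H' = eval_mat x H"
    using interpolableE[OF assms(5,3) F] by blast
  have "N G' * N H' \<le> C * D"
    using G' H' norm_nonneg[OF assms(1)] interpolable_nonneg[OF assms(1,4,2)]
    by (intro mult_mono) auto
  then have "N (G' * H') \<le> C * D" using norm_mult[OF assms(1) G'(1) H'(1)] by simp
  moreover have "\<forall>x\<in>F. eval_mat x (G' * H') = eval_mat x (G * H)"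
    using G' H' assms(2,3) by (simp add: eval_mat_mult[of _ n n _ n] matrices_over_carrier)
  ultimately show "\<exists>K\<in>matrices_over n A. N K \<le> C * D \<and> (\<forall>x\<in>F. eval_mat x K = eval_mat x (G * H))"
    using matrices_over_closed(4)[OF algebra G'(1) H'(1)] by blast
qed (use assms in simp)

lemma interpolable_smult:
  assumes "0 < n" "G \<in> carrier_mat n n" "interpolable A N C G"
  shows "interpolable A N (cmod c * C) (const_fun c \<cdot>\<^sub>m G)"
proof (rule interpolableI)
  fix F :: "'x set" assume F: "finite F"
  obtain G' where G': "G' \<in> matrices_over n A" "N G' \<le> C"
    "\<And>x. x \<in> F \<Longrightarrow> eval_mat x G' = eval_mat x G"
    using interpolableE[OF assms(3,2) F] by blast
  then show "\<exists>K\<in>matrices_over n A. N K \<le> cmod c * C \<and>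
      (\<forall>x\<in>F. eval_mat x K = eval_mat x (const_fun c \<cdot>\<^sub>m G))"
    using matrices_over_closed(5)[OF algebra G'(1)]
    by (intro bexI[of _ "const_fun c \<cdot>\<^sub>m G'"])
      (auto simp: norm_smult[OF assms(1)] eval_mat_smult intro: mult_left_mono)
qed (use assms in simp)

lemma interpolable_compress:
  assumes "0 < m" "0 < n" "G \<in> carrier_mat n n" "interpolable A N C G"
    "L \<in> carrier_mat m n" "M \<in> carrier_mat n m"
  shows "interpolable A N (op_norm_mat L * C * op_norm_mat M)
    (map_mat const_fun L * G * map_mat const_fun M)"
proof (rule interpolableI)
  fix F :: "'x set" assume F: "finite F"
  obtain G' where G': "G' \<in> matrices_over n A" "N G' \<le> C"
    "\<And>x. x \<in> F \<Longrightarrow> eval_mat x G' = eval_mat x G"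
    using interpolableE[OF assms(4,3) F] by blast
  let ?c = "\<lambda>H. map_mat const_fun L * H * map_mat const_fun M"
  have e: "eval_mat x (?c H) = eval_mat x (map_mat const_fun L) * eval_mat x H * eval_mat x (map_mat const_fun M)"
    if "H \<in> carrier_mat n n" for H :: "('x \<Rightarrow> complex) mat" and x
  proof -
    have "eval_mat x (?c H) = eval_mat x (map_mat const_fun L * H) * eval_mat x (map_mat const_fun M)"
      by (rule eval_mat_mult[of _ m n _ m]) (use that assms(5,6) in auto)
    moreover have "eval_mat x (map_mat const_fun L * H) = eval_mat x (map_mat const_fun L) * eval_mat x H"
      by (rule eval_mat_mult[of _ m n _ n]) (use that assms(5,6) in auto)
    ultimately show ?thesis by simp
  qed
  have "N (?c G') \<le> op_norm_mat L * N G' * op_norm_mat M"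
    by (rule norm_compress[OF assms(1,2,5) G'(1) assms(6)])
  also have "\<dots> \<le> op_norm_mat L * C * op_norm_mat M"
    using G'(2) by (intro mult_right_mono mult_left_mono op_norm_mat_nonneg)
  finally show "\<exists>K\<in>matrices_over m A. N K \<le> op_norm_mat L * C * op_norm_mat M \<and>
      (\<forall>x\<in>F. eval_mat x K = eval_mat x (?c G))"
    using matrices_over_closed(7)[OF algebra G'(1) assms(5,6)]
    by (intro bexI[of _ "?c G'"])
      (simp_all add: e[OF assms(3)] e[OF matrices_over_carrier[OF G'(1)]] G'(3) del: assoc_mult_mat)
qed (use assms(5,6) in auto)

lemma interpolable_direct_sum:
  assumes "0 < m" "0 < n" "G \<in> carrier_mat m m" "H \<in> carrier_mat n n"
    "interpolable A N C G" "interpolable A N C H"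
  shows "interpolable A N C (direct_sum_mat G H)"
proof (rule interpolableI)
  fix F :: "'x set" assume F: "finite F"
  obtain G' where G': "G' \<in> matrices_over m A" "N G' \<le> C"
    "\<And>x. x \<in> F \<Longrightarrow> eval_mat x G' = eval_mat x G"
    using interpolableE[OF assms(5,3) F] by blast
  obtain H' where H': "H' \<in> matrices_over n A" "N H' \<le> C"
    "\<And>x. x \<in> F \<Longrightarrow> eval_mat x H' = eval_mat x H"
    using interpolableE[OF assms(6,4) F] by blast
  show "\<exists>K\<in>matrices_over (m + n) A. N K \<le> C \<and>
      (\<forall>x\<in>F. eval_mat x K = eval_mat x (direct_sum_mat G H))"
    using matrices_over_closed(6)[OF algebra G'(1) H'(1)] G' H'
    by (intro bexI[of _ "direct_sum_mat G' H'"])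
      (auto simp: eval_mat_direct_sum norm_direct_sum[OF assms(1,2)])
qed (use assms(3,4) in \<open>auto simp: direct_sum_mat_def\<close>)

text \<open>Supplies the passage from a matrix back to its parts: to the entries of a matrix of BPW
  limits and to the blocks of a direct sum.\<close>

lemma interpolable_submat:
  assumes "0 < m" "0 < n" "G \<in> carrier_mat n n" "interpolable A N C G"
    "inj_on \<sigma> {..<m}" "\<sigma> ` {..<m} \<subseteq> {..<n}" "inj_on \<tau> {..<m}" "\<tau> ` {..<m} \<subseteq> {..<n}"
  shows "interpolable A N C (submat m \<sigma> \<tau> G)"
proof (rule interpolableI)
  fix F :: "'x set" assume F: "finite F"
  obtain G' where G': "G' \<in> matrices_over n A" "N G' \<le> C"
    "\<And>x. x \<in> F \<Longrightarrow> eval_mat x G' = eval_mat x G"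
    using interpolableE[OF assms(4,3) F] by blast
  have "N (submat m \<sigma> \<tau> G') \<le> C"
    using norm_submat_le[OF assms(1,2) G'(1) assms(5-8)] G'(2) by simp
  moreover have "\<forall>x\<in>F. eval_mat x (submat m \<sigma> \<tau> G') = eval_mat x (submat m \<sigma> \<tau> G)"
    by (simp add: G'(3) eval_mat_submat[OF _ assms(6,8)] assms(3) matrices_over_carrier[OF G'(1)])
  ultimately show "\<exists>K\<in>matrices_over m A. N K \<le> C \<and>
      (\<forall>x\<in>F. eval_mat x K = eval_mat x (submat m \<sigma> \<tau> G))"
    using submat_mem_matrices_over[OF G'(1) assms(6,8)] by blast
qed simp

section \<open>Membership in the BPW limits, for functions and for matrices\<close>

lemma mem_bpw_limits_iff: "f \<in> bpw_limits A N \<longleftrightarrow> (\<exists>C. interpolable A N C (mat1 f))"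
proof
  assume "f \<in> bpw_limits A N"
  then obtain C where C: "finite F \<Longrightarrow> e > 0 \<Longrightarrow>
      \<exists>g\<in>A. N (mat1 g) \<le> C \<and> (\<forall>x\<in>F. dist (g x) (f x) < e)" for F e
    unfolding bpw_limits_iff_approx by blast
  \<comment> \<open>Any constant above C would do; the excess is used up by the correction to exact
    values.\<close>
  have "interpolable A N (C + 1) (mat1 f)"
  proof (rule interpolable_if_approx)
    fix F :: "'x set" and e :: real assume "finite F" "e > 0"
    then obtain g where "g \<in> A" "N (mat1 g) \<le> C" "\<forall>x\<in>F. dist (g x) (f x) < e" using C by meson
    then show "\<exists>H\<in>matrices_over (Suc 0) A. N H \<le> C \<and>
        (\<forall>x\<in>F. \<forall>i<Suc 0. \<forall>j<Suc 0. dist ((H $$ (i, j)) x) ((mat1 f $$ (i, j)) x) < e)"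
      by (intro bexI[of _ "mat1 g"]) auto
  qed auto
  then show "\<exists>C. interpolable A N C (mat1 f)" by blast
next
  assume "\<exists>C. interpolable A N C (mat1 f)"
  then obtain C where C: "interpolable A N C (mat1 f)" by blast
  have "\<exists>g\<in>A. N (mat1 g) \<le> C \<and> (\<forall>x\<in>F. dist (g x) (f x) < e)" if F: "finite F" "e > 0" for F e
  proof -
    obtain H where H: "H \<in> matrices_over 1 A" "N H \<le> C"
      "\<forall>x\<in>F. \<forall>i<1. \<forall>j<1. dist ((H $$ (i, j)) x) ((mat1 f $$ (i, j)) x) < e"
      using approx_if_interpolable[OF C mat1_carrier(1) F] by blast
    then show ?thesis
      using mat1_entry[OF matrices_over_carrier[OF H(1)]]
      by (intro bexI[of _ "H $$ (0, 0)"]) (auto simp: matrices_over_def)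
  qed
  then show "f \<in> bpw_limits A N" unfolding bpw_limits_iff_approx by blast
qed

text \<open>Each entry has its own net and its own bound, yet one constant has to serve the whole
  matrix. On every F the entrywise interpolants form a matrix whose norm is bounded by the entry
  norms, independently of F. Conversely, entries are 1 by 1 submatrices. In particular
  \<open>bpw_norm\<close> is a genuine infimum on all these matrices.\<close>

lemma matrices_over_bpw_limits_iff:
  assumes "0 < n"
  shows "G \<in> matrices_over n (bpw_limits A N) \<longleftrightarrow>
    G \<in> carrier_mat n n \<and> (\<exists>C. interpolable A N C G)"
proof
  assume G: "G \<in> matrices_over n (bpw_limits A N)"
  have "\<exists>C. interpolable A N C (mat1 (G $$ p))" if "p \<in> {..<n} \<times> {..<n}" for p
    using G that by (auto simp: matrices_over_def mem_bpw_limits_iff[symmetric])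
  then obtain c where c: "\<And>p. p \<in> {..<n} \<times> {..<n} \<Longrightarrow> interpolable A N (c p) (mat1 (G $$ p))"
    by metis
  obtain K where K: "0 \<le> K" "\<And>G b. G \<in> matrices_over n A \<Longrightarrow>
      (\<And>i j. i < n \<Longrightarrow> j < n \<Longrightarrow> N (mat1 (G $$ (i, j))) \<le> b) \<Longrightarrow> N G \<le> K * b"
    using norm_le_entries[OF assms] by blast
  \<comment> \<open>A common bound for the finitely many entry constants.\<close>
  define b where "b = Max (c ` ({..<n} \<times> {..<n}))"
  have b: "c p \<le> b" if "p \<in> {..<n} \<times> {..<n}" for p
    unfolding b_def using that by (intro Max_ge) auto
  have carr: "G \<in> carrier_mat n n" by (rule matrices_over_carrier[OF G])
  have "interpolable A N (K * b) G"
  proof (rule interpolableI[OF carr])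
    fix F :: "'x set" assume F: "finite F"
    have "\<exists>a. a \<in> A \<and> N (mat1 a) \<le> b \<and> (\<forall>x\<in>F. a x = (G $$ p) x)" if p: "p \<in> {..<n} \<times> {..<n}" for p
    proof -
      obtain H where H: "H \<in> matrices_over 1 A" "N H \<le> c p"
        "\<And>x. x \<in> F \<Longrightarrow> eval_mat x H = eval_mat x (mat1 (G $$ p))"
        using interpolableE[OF c[OF p] mat1_carrier(1) F] by blast
      have "(H $$ (0, 0)) x = (G $$ p) x" if "x \<in> F" for x
        using H(3)[OF that] eval_mat_eq_iff[OF matrices_over_carrier[OF H(1)] mat1_carrier(1), of x]
        by simp
      moreover have "N (mat1 (H $$ (0, 0))) \<le> b" "H $$ (0, 0) \<in> A"
        using mat1_entry[OF matrices_over_carrier[OF H(1)]] H b[OF p] by (auto simp: matrices_over_def)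
      ultimately show ?thesis by blast
    qed
    then obtain h where h: "\<And>p. p \<in> {..<n} \<times> {..<n} \<Longrightarrow>
        h p \<in> A \<and> N (mat1 (h p)) \<le> b \<and> (\<forall>x\<in>F. h p x = (G $$ p) x)" by metis
    have mem: "mat n n h \<in> matrices_over n A" using h by (auto simp: matrices_over_def)
    moreover have "N (mat n n h) \<le> K * b" by (intro K(2)[OF mem]) (use h in auto)
    moreover have "eval_mat x (mat n n h) = eval_mat x G" if "x \<in> F" for x
      using h that by (subst eval_mat_eq_iff[OF _ carr]) auto
    ultimately show "\<exists>H\<in>matrices_over n A. N H \<le> K * b \<and> (\<forall>x\<in>F. eval_mat x H = eval_mat x G)"
      by blast
  qed
  then show "G \<in> carrier_mat n n \<and> (\<exists>C. interpolable A N C G)" using carr by blast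
next
  assume r: "G \<in> carrier_mat n n \<and> (\<exists>C. interpolable A N C G)"
  then obtain C where C: "interpolable A N C G" by blast
  have "G $$ (i, j) \<in> bpw_limits A N" if "i < n" "j < n" for i j
  proof -
    have "submat 1 (\<lambda>_. i) (\<lambda>_. j) G = mat1 (G $$ (i, j))"
      by (intro eq_matI) (auto simp: submat_def)
    then have "interpolable A N C (mat1 (G $$ (i, j)))"
      using interpolable_submat[of 1 n G C "\<lambda>_. i" "\<lambda>_. j"] C r that by (auto simp: inj_on_def)
    then show ?thesis using mem_bpw_limits_iff by blast
  qed
  then show "G \<in> matrices_over n (bpw_limits A N)" using r by (auto simp: matrices_over_def)
qed

section \<open>The algebra of BPW limits\<close>

lemma subset_bpw_limits: "A \<subseteq> bpw_limits A N"
proof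
  fix f assume "f \<in> A"
  then have "interpolable A N (N (mat1 f)) (mat1 f)" by (intro interpolable_self[of _ "Suc 0"]) auto
  then show "f \<in> bpw_limits A N" unfolding mem_bpw_limits_iff by blast
qed

lemma bpw_limits_algebra: "function_algebra (bpw_limits A N)"
  unfolding function_algebra_def
proof (intro conjI allI ballI)
  fix c show "const_fun c \<in> bpw_limits A N"
    using function_algebra_closed(1)[OF algebra] subset_bpw_limits by blast
next
  fix f g assume "f \<in> bpw_limits A N" "g \<in> bpw_limits A N"
  then obtain C D where CD: "interpolable A N C (mat1 f)" "interpolable A N D (mat1 g)"
    by (auto simp: mem_bpw_limits_iff)
  then have "interpolable A N (C + D) (mat1 f + mat1 g)" "interpolable A N (C * D) (mat1 f * mat1 g)"
    by (auto intro!: interpolable_add[of "Suc 0"] interpolable_mult[of "Suc 0"])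
  moreover have "mat1 (f + g) = mat1 f + mat1 g" "mat1 (f * g) = mat1 f * mat1 g"
    by (auto simp: mat1_def scalar_prod_def intro!: eq_matI)
  ultimately show "f + g \<in> bpw_limits A N" "f * g \<in> bpw_limits A N"
    unfolding mem_bpw_limits_iff by metis+
qed

lemma interpolable_above_bpw_norm:
  assumes "0 < n" "G \<in> matrices_over n (bpw_limits A N)" "bpw_norm A N G < C"
  shows "interpolable A N C G"
proof -
  obtain C\<^sub>0 where "interpolable A N C\<^sub>0 G" using assms by (auto simp: matrices_over_bpw_limits_iff)
  then show ?thesis
    using interpolable_if_bpw_norm_less[OF assms(1) matrices_over_carrier[OF assms(2)]] assms(3)
    by blast
qed

text \<open>The passage to the infimum, used for most of the norm inequalities below: it suffices to
  prove them with an arbitrary interpolation constant in place of the norm.\<close>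

lemma le_bpw_norm:
  assumes "0 < n" "G \<in> matrices_over n (bpw_limits A N)" "0 \<le> l"
    and le: "\<And>C. interpolable A N C G \<Longrightarrow> b \<le> l * C"
  shows "b \<le> l * bpw_norm A N G"
proof (rule field_le_epsilon)
  fix e :: real assume "0 < e"
  \<comment> \<open>The excess d over the norm is scaled so that l times d stays below e; the
    summand 1 allows l = 0.\<close>
  define d where "d = e / (l + 1)"
  have d: "0 < d" "l * d \<le> e" using \<open>0 < e\<close> \<open>0 \<le> l\<close> by (auto simp: d_def field_simps)
  have "b \<le> l * (bpw_norm A N G + d)"
    by (intro le interpolable_above_bpw_norm[OF assms(1,2)]) (use d in simp)
  then show "b \<le> l * bpw_norm A N G + e" using d(2) by (simp add: distrib_left)
qed

lemma bpw_norm_nonneg: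
  assumes "0 < n" "G \<in> matrices_over n (bpw_limits A N)"
  shows "0 \<le> bpw_norm A N G"
  using le_bpw_norm[OF assms, of 1 0] interpolable_nonneg[OF assms(1) _ matrices_over_carrier[OF assms(2)]]
  by simp

text \<open>Interpolating on the single point x replaces G by a matrix over \<open>A\<close>, where
  evaluation is bounded. As K depends only on x, this yields both definiteness of
  \<open>bpw_norm\<close> and bounded evaluations on the BPW limits.\<close>

lemma bpw_eval_bounded:
  obtains K where "\<And>n G i j. 0 < n \<Longrightarrow> G \<in> matrices_over n (bpw_limits A N) \<Longrightarrow> i < n \<Longrightarrow> j < n \<Longrightarrow>
    cmod ((G $$ (i, j)) x) \<le> K * bpw_norm A N G"
proof -
  obtain M where M: "\<forall>f\<in>A. cmod (f x) \<le> M * N (mat1 f)" using eval_bounded by blast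
  have "cmod ((G $$ (i, j)) x) \<le> \<bar>M\<bar> * bpw_norm A N G"
    if n: "0 < n" and G: "G \<in> matrices_over n (bpw_limits A N)" and ij: "i < n" "j < n" for n G i j
  proof (rule le_bpw_norm[OF n G])
    fix C assume C: "interpolable A N C G"
    obtain H where H: "H \<in> matrices_over n A" "N H \<le> C" "eval_mat x H = eval_mat x G"
      using interpolableE[OF C matrices_over_carrier[OF G], of "{x}"] by blast
    have h: "H $$ (i, j) \<in> A" using H(1) ij by (auto simp: matrices_over_def)
    have "(G $$ (i, j)) x = (H $$ (i, j)) x"
      using H(3) ij eval_mat_eq_iff[OF matrices_over_carrier[OF H(1)] matrices_over_carrier[OF G]]
      by auto
    then have "cmod ((G $$ (i, j)) x) \<le> M * N (mat1 (H $$ (i, j)))" using M h by simp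
    also have "\<dots> \<le> \<bar>M\<bar> * C"
      using norm_entry_le[OF n H(1) ij] H(2) h
      by (intro mult_mono) (auto intro: norm_nonneg[of 1])
    finally show "cmod ((G $$ (i, j)) x) \<le> \<bar>M\<bar> * C" .
  qed simp
  then show ?thesis by (rule that)
qed

lemma bpw_norm_eq_0_iff:
  assumes n: "0 < n" and G: "G \<in> matrices_over n (bpw_limits A N)"
  shows "bpw_norm A N G = 0 \<longleftrightarrow> G = 0\<^sub>m n n"
proof
  assume 0: "bpw_norm A N G = 0"
  have "(G $$ (i, j)) x = 0" if "i < n" "j < n" for i j x
    using bpw_eval_bounded[of x thesis for thesis] n G that 0
    by (metis mult_zero_right norm_le_zero_iff)
  then show "G = 0\<^sub>m n n" using matrices_over_carrier[OF G] by (intro eq_matI) (auto simp: fun_eq_iff)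
next
  assume 0: "G = 0\<^sub>m n n"
  have "0\<^sub>m n n \<in> matrices_over n A"
    by (auto simp: matrices_over_def function_algebra_closed[OF algebra])
  then have "interpolable A N 0 G"
    unfolding 0 by (rule interpolable_self) (simp add: norm_zero[OF n])
  then show "bpw_norm A N G = 0"
    using bpw_norm_le[OF n matrices_over_carrier[OF G]] bpw_norm_nonneg[OF n G] by fastforce
qed

lemma bpw_norm_smult_le:
  assumes n: "0 < n" and G: "G \<in> matrices_over n (bpw_limits A N)"
  shows "bpw_norm A N (const_fun c \<cdot>\<^sub>m G) \<le> cmod c * bpw_norm A N G"
proof (rule le_bpw_norm[OF n G])
  note carr = matrices_over_carrier[OF G]
  show "bpw_norm A N (const_fun c \<cdot>\<^sub>m G) \<le> cmod c * C" if "interpolable A N C G" for C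
    by (rule bpw_norm_le[OF n _ interpolable_smult[OF n carr that]]) (use carr in simp)
qed simp

text \<open>The missing inequality comes from scaling back by 1/c when c is nonzero, and from
  nonnegativity otherwise.\<close>

lemma bpw_norm_smult:
  assumes n: "0 < n" and G: "G \<in> matrices_over n (bpw_limits A N)"
  shows "bpw_norm A N (const_fun c \<cdot>\<^sub>m G) = cmod c * bpw_norm A N G"
proof (rule antisym[OF bpw_norm_smult_le[OF assms]])
  have cG: "const_fun c \<cdot>\<^sub>m G \<in> matrices_over n (bpw_limits A N)"
    by (rule matrices_over_closed(5)[OF bpw_limits_algebra G])
  show "cmod c * bpw_norm A N G \<le> bpw_norm A N (const_fun c \<cdot>\<^sub>m G)"
  proof (cases "c = 0")
    case False
    have "const_fun (1 / c) \<cdot>\<^sub>m (const_fun c \<cdot>\<^sub>m G) = G"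
      using False by (intro eq_matI) (auto simp: fun_eq_iff)
    then have "bpw_norm A N G \<le> cmod (1 / c) * bpw_norm A N (const_fun c \<cdot>\<^sub>m G)"
      using bpw_norm_smult_le[OF n cG, of "1 / c"] by simp
    then show ?thesis using False by (simp add: norm_divide field_simps)
  qed (use bpw_norm_nonneg[OF n cG] in simp)
qed

lemma bpw_norm_triangle:
  assumes n: "0 < n" and G: "G \<in> matrices_over n (bpw_limits A N)"
    and H: "H \<in> matrices_over n (bpw_limits A N)"
  shows "bpw_norm A N (G + H) \<le> bpw_norm A N G + bpw_norm A N H"
proof (rule field_le_epsilon)
  fix e :: real assume e: "0 < e"
  have "interpolable A N ((bpw_norm A N G + e / 2) + (bpw_norm A N H + e / 2)) (G + H)"
    using e by (intro interpolable_add[OF n] matrices_over_carrier[OF G] matrices_over_carrier[OF H]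
        interpolable_above_bpw_norm[OF n G] interpolable_above_bpw_norm[OF n H]) auto
  from bpw_norm_le[OF n _ this] show "bpw_norm A N (G + H) \<le> bpw_norm A N G + bpw_norm A N H + e"
    using matrices_over_carrier[OF G] matrices_over_carrier[OF H] by simp
qed

lemma bpw_norm_compress:
  assumes "0 < m" "0 < n" "L \<in> carrier_mat m n" and G: "G \<in> matrices_over n (bpw_limits A N)"
    and "M \<in> carrier_mat n m"
  shows "bpw_norm A N (map_mat const_fun L * G * map_mat const_fun M)
    \<le> op_norm_mat L * bpw_norm A N G * op_norm_mat M"
proof -
  have "bpw_norm A N (map_mat const_fun L * G * map_mat const_fun M)
      \<le> (op_norm_mat L * op_norm_mat M) * bpw_norm A N G"
  proof (rule le_bpw_norm[OF assms(2) G])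
    fix C assume "interpolable A N C G"
    from interpolable_compress[OF assms(1,2) matrices_over_carrier[OF G] this assms(3,5)]
    have "bpw_norm A N (map_mat const_fun L * G * map_mat const_fun M)
        \<le> op_norm_mat L * C * op_norm_mat M"
      by (rule bpw_norm_le[OF assms(1), rotated]) (use assms in auto)
    then show "bpw_norm A N (map_mat const_fun L * G * map_mat const_fun M)
        \<le> (op_norm_mat L * op_norm_mat M) * C" by (simp add: mult_ac)
  qed (simp add: op_norm_mat_nonneg)
  then show ?thesis by (simp add: mult_ac)
qed

lemma bpw_norm_submat_le:
  assumes "0 < m" "0 < n" and G: "G \<in> matrices_over n (bpw_limits A N)"
    and "inj_on \<sigma> {..<m}" "\<sigma> ` {..<m} \<subseteq> {..<n}" "inj_on \<tau> {..<m}" "\<tau> ` {..<m} \<subseteq> {..<n}"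
  shows "bpw_norm A N (submat m \<sigma> \<tau> G) \<le> bpw_norm A N G"
  using le_bpw_norm[OF assms(2) G, of 1 "bpw_norm A N (submat m \<sigma> \<tau> G)"]
    bpw_norm_le[OF assms(1) submat_carrier
      interpolable_submat[OF assms(1,2) matrices_over_carrier[OF G] _ assms(4-7)]]
  by simp

text \<open>Interpolants of both blocks under one common bound give the upper estimate; the lower
  one holds because each block is a submatrix of the sum.\<close>

lemma bpw_norm_direct_sum:
  assumes m: "0 < m" and n: "0 < n" and G: "G \<in> matrices_over m (bpw_limits A N)"
    and H: "H \<in> matrices_over n (bpw_limits A N)"
  shows "bpw_norm A N (direct_sum_mat G H) = max (bpw_norm A N G) (bpw_norm A N H)"
proof (rule antisym)
  note carr = matrices_over_carrier[OF G] matrices_over_carrier[OF H]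
  show "bpw_norm A N (direct_sum_mat G H) \<le> max (bpw_norm A N G) (bpw_norm A N H)"
  proof (rule field_le_epsilon)
    fix e :: real assume e: "0 < e"
    have "interpolable A N (max (bpw_norm A N G) (bpw_norm A N H) + e) (direct_sum_mat G H)"
      using e by (intro interpolable_direct_sum[OF m n carr]
          interpolable_above_bpw_norm[OF m G] interpolable_above_bpw_norm[OF n H]) auto
    then show "bpw_norm A N (direct_sum_mat G H) \<le> max (bpw_norm A N G) (bpw_norm A N H) + e"
      by (rule bpw_norm_le[of "m + n", rotated 2]) (use m carr in \<open>auto simp: direct_sum_mat_def\<close>)
  qed
  have GH: "direct_sum_mat G H \<in> matrices_over (m + n) (bpw_limits A N)"
    by (rule matrices_over_closed(6)[OF bpw_limits_algebra G H])
  have "bpw_norm A N G \<le> bpw_norm A N (direct_sum_mat G H)"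
    using bpw_norm_submat_le[OF m _ GH, of "\<lambda>i. i" "\<lambda>i. i"] m submat_direct_sum(1)[OF carr] by auto
  moreover have "bpw_norm A N H \<le> bpw_norm A N (direct_sum_mat G H)"
    using bpw_norm_submat_le[OF n _ GH, of "\<lambda>i. m + i" "\<lambda>i. m + i"] m submat_direct_sum(2)[OF carr]
    by (auto simp: image_subset_iff)
  ultimately show "max (bpw_norm A N G) (bpw_norm A N H) \<le> bpw_norm A N (direct_sum_mat G H)" by simp
qed

text \<open>Two infima are taken in succession: over the constants C of G with D fixed, then over
  the constants D of H.\<close>

lemma bpw_norm_mult:
  assumes n: "0 < n" and G: "G \<in> matrices_over n (bpw_limits A N)"
    and H: "H \<in> matrices_over n (bpw_limits A N)"
  shows "bpw_norm A N (G * H) \<le> bpw_norm A N G * bpw_norm A N H"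
proof (rule le_bpw_norm[OF n H bpw_norm_nonneg[OF n G]])
  note carr = matrices_over_carrier[OF G] matrices_over_carrier[OF H]
  fix D assume D: "interpolable A N D H"
  have "bpw_norm A N (G * H) \<le> D * bpw_norm A N G"
  proof (rule le_bpw_norm[OF n G interpolable_nonneg[OF n D carr(2)]])
    fix C assume "interpolable A N C G"
    from bpw_norm_le[OF n _ interpolable_mult[OF n carr this D]] carr
    show "bpw_norm A N (G * H) \<le> D * C" by (simp add: mult.commute)
  qed
  then show "bpw_norm A N (G * H) \<le> bpw_norm A N G * D" by (simp add: mult.commute)
qed

text \<open>For the lower bound, t = \<open>bpw_norm A N (mat1 1)\<close> satisfies t \<le> t * t
  because 1 is idempotent, and t is nonzero by definiteness.\<close>

lemma bpw_norm_one: "bpw_norm A N (mat1 1) = 1"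
proof (rule antisym)
  have pos: "0 < (1 :: nat)" by simp
  have one: "mat1 1 \<in> matrices_over (Suc 0) A" by (simp add: function_algebra_closed[OF algebra])
  then have one': "mat1 1 \<in> matrices_over 1 (bpw_limits A N)" using subset_bpw_limits by auto
  have "interpolable A N 1 (mat1 1)" by (rule interpolable_self[OF one]) (simp add: norm_one)
  then show "bpw_norm A N (mat1 1) \<le> 1" by (intro bpw_norm_le[of "Suc 0"]) auto
  have "mat1 1 * mat1 1 = (mat1 1 :: ('x \<Rightarrow> complex) mat)"
    by (intro eq_matI) (auto simp: mat1_def scalar_prod_def)
  then have "bpw_norm A N (mat1 1) \<le> bpw_norm A N (mat1 1) * bpw_norm A N (mat1 1)"
    using bpw_norm_mult[OF pos one' one'] by simp
  moreover have "bpw_norm A N (mat1 1) \<noteq> 0"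
  proof
    assume "bpw_norm A N (mat1 1) = 0"
    then have "mat1 1 = (0\<^sub>m 1 1 :: ('x \<Rightarrow> complex) mat)"
      using bpw_norm_eq_0_iff[OF pos one'] by simp
    then have "mat1 1 $$ (0, 0) = (0\<^sub>m 1 1 :: ('x \<Rightarrow> complex) mat) $$ (0, 0)" by simp
    then show False by (simp add: mat1_def)
  qed
  ultimately show "1 \<le> bpw_norm A N (mat1 1)"
    using bpw_norm_nonneg[OF pos one'] by simp
qed

lemma bpw_operator_algebra: "operator_algebra_of_functions (bpw_limits A N) (bpw_norm A N)"
  unfolding operator_algebra_of_functions_def
proof (intro conjI allI impI)
  fix x y :: 'x assume "x \<noteq> y"
  then show "\<exists>f\<in>bpw_limits A N. f x \<noteq> f y" using separating subset_bpw_limits by blast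
next
  fix n :: nat assume "0 < n"
  then show "norm_on_matrices n (bpw_limits A N) (bpw_norm A N)"
    by (simp add: norm_on_matrices_def bpw_norm_nonneg bpw_norm_eq_0_iff bpw_norm_smult bpw_norm_triangle)
next
  show "BRS_axioms (bpw_limits A N) (bpw_norm A N)"
    by (simp add: BRS_axioms_def bpw_norm_compress bpw_norm_direct_sum bpw_norm_mult bpw_norm_one)
next
  fix x :: 'x
  obtain K where K: "\<And>n G i j. 0 < n \<Longrightarrow> G \<in> matrices_over n (bpw_limits A N) \<Longrightarrow> i < n \<Longrightarrow> j < n \<Longrightarrow>
    cmod ((G $$ (i, j)) x) \<le> K * bpw_norm A N G" using bpw_eval_bounded by blast
  show "\<exists>K. \<forall>f\<in>bpw_limits A N. cmod (f x) \<le> K * bpw_norm A N (mat1 f)"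
    using K[of "Suc 0" "mat1 _" 0 0] by (intro exI[of _ K]) auto
qed (rule bpw_limits_algebra)

section \<open>Completeness, localization, density and locality\<close>

text \<open>An approximant g from the BPW limits can be replaced on F by an element of
  \<open>A\<close> with the same values there. The distance to f on F is unchanged, and the bound
  grows from C to C + 1 whatever F and e are.\<close>

lemma bpw_limits_complete: "bpw_complete (bpw_limits A N) (bpw_norm A N)"
  unfolding bpw_complete_def
proof
  show "bpw_limits A N \<subseteq> bpw_limits (bpw_limits A N) (bpw_norm A N)"
    unfolding bpw_limits_iff_approx[of _ "bpw_limits A N"] subset_iff
    by (metis dist_self order_refl)
  show "bpw_limits (bpw_limits A N) (bpw_norm A N) \<subseteq> bpw_limits A N"
  proof
    fix f assume "f \<in> bpw_limits (bpw_limits A N) (bpw_norm A N)"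
    then obtain C where C: "finite F \<Longrightarrow> e > 0 \<Longrightarrow> \<exists>g\<in>bpw_limits A N.
        bpw_norm A N (mat1 g) \<le> C \<and> (\<forall>x\<in>F. dist (g x) (f x) < e)" for F e
      unfolding bpw_limits_iff_approx[of _ "bpw_limits A N"] by meson
    have "\<exists>a\<in>A. N (mat1 a) \<le> C + 1 \<and> (\<forall>x\<in>F. dist (a x) (f x) < e)" if F: "finite F" "e > 0" for F e
    proof -
      obtain g where g: "g \<in> bpw_limits A N" "bpw_norm A N (mat1 g) \<le> C" "\<forall>x\<in>F. dist (g x) (f x) < e"
        using C[OF F] by blast
      have "interpolable A N (C + 1) (mat1 g)"
        using g by (intro interpolable_above_bpw_norm[of "Suc 0"]) auto
      then obtain H where H: "H \<in> matrices_over 1 A" "N H \<le> C + 1"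
        "\<And>x. x \<in> F \<Longrightarrow> eval_mat x H = eval_mat x (mat1 g)"
        using interpolableE[OF _ mat1_carrier(1) F(1)] by blast
      have "(H $$ (0, 0)) x = g x" if "x \<in> F" for x
        using H(3)[OF that] eval_mat_eq_iff[OF matrices_over_carrier[OF H(1)] mat1_carrier(1), of x]
        by simp
      then show ?thesis
        using g(3) H(1,2) mat1_entry[OF matrices_over_carrier[OF H(1)]]
        by (intro bexI[of _ "H $$ (0, 0)"]) (auto simp: matrices_over_def)
    qed
    then show "f \<in> bpw_limits A N" unfolding bpw_limits_iff_approx by blast
  qed
qed

text \<open>Both norms are the infimum of the same interpolation constants: one comes from cosets
  modulo the ideals, the other from nets.\<close>

lemma local_norm_eq_bpw_norm:
  assumes n: "0 < n" and G: "G \<in> matrices_over n A"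
  shows "local_norm A N G = bpw_norm A N G"
proof (rule antisym)
  have G': "G \<in> matrices_over n (bpw_limits A N)"
    using G matrices_over_mono[OF subset_bpw_limits] by blast
  show "local_norm A N G \<le> bpw_norm A N G"
    using le_bpw_norm[OF n G', of 1 "local_norm A N G"]
      local_norm_le[OF algebra norm_nonneg[OF n] G] by simp
  show "bpw_norm A N G \<le> local_norm A N G"
  proof (rule dense_ge)
    fix C assume "local_norm A N G < C"
    from interpolable_if_local_norm_less[OF algebra norm_nonneg[OF n] G this]
    show "bpw_norm A N G \<le> C" by (rule bpw_norm_le[OF n matrices_over_carrier[OF G]])
  qed
qed

text \<open>On \<open>A\<close> the new norm is at most \<open>N\<close>, since each element
  interpolates itself; approximants bounded in \<open>N\<close> are therefore bounded in
  \<open>bpw_norm\<close> as well.\<close>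

lemma bpw_limits_dense: "bpw_dense_subalgebra A (bpw_limits A N) (bpw_norm A N)"
proof -
  have "bpw_norm A N (mat1 g) \<le> N (mat1 g)" if "g \<in> A" for g
    using that by (intro bpw_norm_le[of "Suc 0"] interpolable_self[of _ "Suc 0"]) auto
  then have "f \<in> bpw_limits A (bpw_norm A N)" if "f \<in> bpw_limits A N" for f
    using that unfolding bpw_limits_iff_approx by (meson order_trans)
  then show ?thesis
    using algebra subset_bpw_limits by (auto simp: bpw_dense_subalgebra_def)
qed

lemma bpw_limits_local: "local_algebra (bpw_limits A N) (bpw_norm A N)"
  unfolding local_algebra_def
proof (intro allI impI ballI antisym)
  fix n G assume n: "0 < n" and G: "G \<in> matrices_over n (bpw_limits A N)"
  note loc = bpw_limits_algebra bpw_norm_nonneg[OF n] G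
  note carr = matrices_over_carrier[OF G]
  show "local_norm (bpw_limits A N) (bpw_norm A N) G \<le> bpw_norm A N G"
    by (rule local_norm_le[OF loc interpolable_self[OF G order_refl]])
  show "bpw_norm A N G \<le> local_norm (bpw_limits A N) (bpw_norm A N) G"
  proof (rule dense_ge)
    fix C assume less: "local_norm (bpw_limits A N) (bpw_norm A N) G < C"
    \<comment> \<open>Two gaps are needed: the one below C' to obtain an interpolant H among
      matrices of BPW limits, the one between C' and C to replace H on the same F by a matrix over
      \<open>A\<close>.\<close>
    then obtain C' where C': "local_norm (bpw_limits A N) (bpw_norm A N) G < C'" "C' < C"
      using dense by blast
    have "interpolable A N C G"
    proof (rule interpolableI[OF carr])
      fix F :: "'x set" assume F: "finite F"
      obtain H where H: "H \<in> matrices_over n (bpw_limits A N)" "bpw_norm A N H \<le> C'"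
        "\<And>x. x \<in> F \<Longrightarrow> eval_mat x H = eval_mat x G"
        using interpolableE[OF interpolable_if_local_norm_less[OF loc C'(1)] carr F] by blast
      have "interpolable A N C H"
        using interpolable_above_bpw_norm[OF n H(1)] H(2) C'(2) by simp
      then obtain K where K: "K \<in> matrices_over n A" "N K \<le> C"
        "\<And>x. x \<in> F \<Longrightarrow> eval_mat x K = eval_mat x H"
        using interpolableE[OF _ matrices_over_carrier[OF H(1)] F] by blast
      then show "\<exists>K\<in>matrices_over n A. N K \<le> C \<and> (\<forall>x\<in>F. eval_mat x K = eval_mat x G)"
        using H(3) by (intro bexI[of _ K]) auto
    qed
    then show "bpw_norm A N G \<le> C" by (rule bpw_norm_le[OF n carr])
  qed
qed

end

theorem theorem1p12:
  fixes A :: "('x \<Rightarrow> complex) set"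
    and N :: "('x \<Rightarrow> complex) mat \<Rightarrow> real"
  assumes "operator_algebra_of_functions A N"
  shows "operator_algebra_of_functions (bpw_limits A N) (bpw_norm A N) \<and>
    bpw_complete (bpw_limits A N) (bpw_norm A N) \<and>
    local_algebra (bpw_limits A N) (bpw_norm A N) \<and>
    completely_isometric_subalgebra A (local_norm A N) (bpw_limits A N) (bpw_norm A N) \<and>
    bpw_dense_subalgebra A (bpw_limits A N) (bpw_norm A N)"
proof -
  interpret function_operator_algebra A N by unfold_locales (rule assms)
  have embed: "completely_isometric_subalgebra A (local_norm A N) (bpw_limits A N) (bpw_norm A N)"
    using algebra subset_bpw_limits local_norm_eq_bpw_norm
    by (simp add: completely_isometric_subalgebra_def)
  show ?thesis
    using bpw_operator_algebra bpw_limits_complete bpw_limits_local embed bpw_limits_dense by simp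
qed

end
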